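(* Let $\mathcal{S}=\{S_l\}_{l\in\mathcal{I}}$ be a cell decomposition of $D$ with diameter $d_{\max}:=\sup\{\mathrm{diam}(S_l):l\in\mathcal{I}\}$, let $\delta t>0$ be a time step, let $\lambda\in(0,1)$, $\mu>0$, let $W:=B(\lambda v_{\max})$ and $$L:=\max\{3L_2+4L_1\sqrt{N_i}: i\in\mathcal{N}\}.$$ Assume that $\lambda,\mu,d_{\max},\delta t$ satisfy one of the following: Case I: $0\le\mu\le\frac{2\lambda}{1-\lambda}$, and (a) $d_{\max}\in\left(0,\frac{(1-\lambda)^2v_{\max}^2}{4ML}\right]$, (b) $\delta t\in\left[\frac{(1-\lambda)v_{\max}-\sqrt{(1-\lambda)^2v_{\max}^2-4MLd_{\max}}}{2ML},\frac{(1-\lambda)v_{\max}+\sqrt{(1-\lambda)^2v_{\max}^2-4MLd_{\max}}}{2ML}\right]$. Case II: $\frac{2\lambda}{1-\lambda}<\mu<\frac{4\lambda}{1-\lambda}$, and either (c) $d_{\max}\in\left(0,\frac{2(\lambda(1-\lambda)\mu-2\lambda^2)v_{\max}^2}{\mu^2ML}\right]$ and (d) $\delta t\in\left[\frac{\mu}{2\lambda v_{\max}}d_{\max},\frac{(1-\lambda)v_{\max}+\sqrt{(1-\lambda)^2v_{\max}^2-4MLd_{\max}}}{2ML}\right]$, or $d_{\max}\in\left(\frac{2(\lambda(1-\lambda)\mu-2\lambda^2)v_{\max}^2}{\mu^2ML},\frac{(1-\lambda)^2v_{\max}^2}{4ML}\right]$ and $\delta t$ satisfies (b). Case III: $\mu\ge\frac{4\lambda}{1-\lambda}$,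 and $d_{\max}$, $\delta t$ satisfy (c) and (d). Then for each agent $i\in\mathcal{N}$ and each cell configuration $\mathbf{l}_i=(l_i,l_{j_1},\ldots,l_{j_{N_i}})$ of $i$, there exist at least $\lfloor\mu^n\rfloor+1$ possible discrete transitions if $\mu^n\notin\mathbb{N}$, and at least $\lfloor\mu^n\rfloor$ if $\mu^n\in\mathbb{N}$; that is, the set $\mathrm{Post}_i(l_i;\mathbf{l}_i)$ has at least that many elements.
   Context: Notation: $|\cdot|$ is the Euclidean norm; $B(R)$ is the closed ball of radius $R$ centered at $0$ in $\mathbb{R}^n$; $A+B$ is the Minkowski sum; $\lfloor a\rfloor$ is the integer part of $a\ge0$. System. $\mathcal{N}=\{1,\ldots,N\}$ is the set of agents; each agent $i$ has a set of neighbors $\mathcal{N}_i\subset\mathcal{N}\setminus\{i\}$ of cardinality $N_i$, ordered as $j_1,\ldots,j_{N_i}$ (depending on $i$; write $j(i)=(j_1,\ldots,j_{N_i})$), and $\mathbf{x}_j=\mathbf{x}_{j(i)}:=(x_{j_1},\ldots,x_{j_{N_i}})$. $D\subset\mathbb{R}^n$ is a domain (nonempty, open, connected). The multi-agent system is $\dot x_i=f_i(x_i,\mathbf{x}_j)+v_i$, $x_i\in D$, $i\in\mathcal{N}$, with $f_i:D^{N_i+1}\to\mathbb{R}^n$ and $|f_i|\le M$ on $D^{N_i+1}$; free inputs $v_i$ are piecewise continuous with $|v_i(t)|\le v_{\max}$ for all $t\ge0$; $0<v_{\max}<M$. There are Lipschitz constants $L_1,L_2>0$ with $|f_i(x_i,\mathbf{x}_j)-f_i(x_i,\mathbf{y}_j)|\le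 L_1|(x_i,\mathbf{x}_j)-(x_i,\mathbf{y}_j)|$ and $|f_i(x_i,\mathbf{x}_j)-f_i(y_i,\mathbf{x}_j)|\le L_2|(x_i,\mathbf{x}_j)-(y_i,\mathbf{x}_j)|$ for all $x_i,y_i\in D$, $\mathbf{x}_j,\mathbf{y}_j\in D^{N_i}$, $i\in\mathcal{N}$. Invariance Assumption: for every $x(0)\in D^N$ and every piecewise continuous $v=(v_1,\ldots,v_N):[0,\infty)\to\mathbb{R}^{Nn}$ with $|v_i(t)|\le v_{\max}$ for all $t\ge 0$, $i\in\mathcal{N}$, the unique solution of the system is defined and remains in $D^N$ for all $t\ge0$. Cell decomposition. A cell decomposition of $D$ is a finite or countable family $\{S_l\}_{l\in\mathcal{I}}$ of nonempty connected subsets of $D$ with $\sup_l\mathrm{diam}(S_l)<\infty$, $\mathrm{cl}(\mathrm{int}(S_l))=S_l$ (closure relative to $D$), $\mathrm{int}(S_l)\cap\mathrm{int}(S_{\hat l})=\emptyset$ for $l\ne\hat l$, and $\bigcup_l S_l=D$. For $\mathbf{l}=(l_1,\ldots,l_N)\in\mathcal{I}^N$ (a cell configuration) put $\mathrm{pr}_i(\mathbf{l}):=(l_i,l_{j_1},\ldots,l_{j_{N_i}})\in\mathcal{I}^{N_i+1}$; elements $\mathbf{l}_i=(l_i,l_{j_1},\ldots,l_{j_{N_i}})$ of $\mathcal{I}^{N_i+1}$ are cell configurations of agent $i$. Property (P). Let $R_{\max}:=\delta t(M+v_{\max})$ and let $W\subset\mathbb{R}^n$ be nonempty. A feedback law for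 agent $i$ and cell configuration $\mathbf{l}_i$ is a family of times $T(x_{i0},w_i)>0$ (possibly $+\infty$) and maps $k_{i,\mathbf{l}_i}(\cdot;x_{i0},w_i):[0,T(x_{i0},w_i))\times D^{N_i+1}\to\mathbb{R}^n$, parameterized by $x_{i0}\in S_{l_i}$, $w_i\in W$. It satisfies Property (P) if: (P1) each $k_{i,\mathbf{l}_i}(\cdot;x_{i0},w_i)$ is locally Lipschitz continuous; (P2) $|k_{i,\mathbf{l}_i}(t,x_i,\mathbf{x}_j;x_{i0},w_i)|\le v_{\max}$ for all $t\in[0,\delta t]\cap[0,T(x_{i0},w_i))$, $x_i\in(S_{l_i}+B(R_{\max}))\cap D$, $x_{j_m}\in(S_{l_{j_m}}+B(R_{\max}))\cap D$ ($m=1,\ldots,N_i$), $x_{i0}\in S_{l_i}$, $w_i\in W$; (P3) $T(x_{i0},w_i)>\delta t$ for all $x_{i0}\in S_{l_i}$, $w_i\in W$. Condition (C). Given $\mathbf{l}_i$, a feedback law $k_{i,\mathbf{l}_i}$ satisfying (P), $w_i\in W$ and $l_i'\in\mathcal{I}$, Condition (C) holds if for each cell configuration $\mathbf{l}$ with $\mathrm{pr}_i(\mathbf{l})=\mathbf{l}_i$, all feedback laws $k_{\ell,\mathrm{pr}_\ell(\mathbf{l})}$, $\ell\in\mathcal{N}\setminus\{i\}$, satisfying (P), all $w_\ell\in W$ ($\ell\neq i$) and all $x(0)\in D^N$ with $x_m(0)=x_{m0}\in S_{l_m}$ ($m\in\mathcal{N}$), the solution of the closed-loop system with $v_i=k_{i,\mathbf{l}_i}(t,x_i,\mathbf{x}_{j(i)};x_{i0},w_i)$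 and $v_\ell=k_{\ell,\mathrm{pr}_\ell(\mathbf{l})}(t,x_\ell,\mathbf{x}_{j(\ell)};x_{\ell0},w_\ell)$ is well defined on $[0,\delta t]$ and $x_i(\delta t)\in S_{l_i'}$. Transitions. The (discrete) transition $l_i\overset{\mathbf{l}_i}{\longrightarrow}l_i'$ is well posed if there exist a feedback law $k_{i,\mathbf{l}_i}$ satisfying (P) and $w_i\in W$ such that $\mathbf{l}_i,k_{i,\mathbf{l}_i},w_i,l_i'$ satisfy (C). $\mathrm{Post}_i(l_i;\mathbf{l}_i)$ is the set of $l_i'\in\mathcal{I}$ for which this transition is well posed. Here these notions are taken with $W=B(\lambda v_{\max})$. *)

theory Defs
  imports "HOL-Analysis.Analysis" "HOL-Library.Set_Algebras"
begin

text \<open>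
  The agents are the elements of a finite type \<open>'i\<close>, the state space is \<open>real ^ 'n\<close>, and
  \<open>real ^ 'n ^ 'i\<close> is the joint state space. The ordered neighbors of \<open>i\<close> form the distinct list
  \<open>nbr i\<close>, so that \<open>N\<^sub>i = length (nbr i)\<close> may depend on \<open>i\<close> and may be 0. Neighbor states and
  neighbor cell labels are lists of that length.
\<close>

definition tuples :: "nat \<Rightarrow> 'b set \<Rightarrow> 'b list set" where
  "tuples m A = {xs. length xs = m \<and> set xs \<subseteq> A}"

text \<open>Euclidean distance between tuples of equal length, seen as elements of \<open>(real ^ 'n) ^ m\<close>.\<close>

definition tuple_dist :: "(real ^ 'n) list \<Rightarrow> (real ^ 'n) list \<Rightarrow> real" where
  "tuple_dist xs ys = L2_set (\<lambda>m. dist (xs ! m) (ys ! m)) {..<length xs}"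

abbreviation nbr_states :: "('i::finite \<Rightarrow> 'i list) \<Rightarrow> 'i \<Rightarrow> (real ^ 'n) ^ 'i \<Rightarrow> (real ^ 'n) list" where
  "nbr_states nbr i x \<equiv> map (\<lambda>j. x $ j) (nbr i)"

definition piecewise_continuous :: "(real \<Rightarrow> 'b::t2_space) \<Rightarrow> bool" where
  "piecewise_continuous v \<longleftrightarrow>
     (\<forall>b. finite {t \<in> {0..b}. \<not> continuous (at t within {0..}) v}) \<and>
     (\<forall>t\<ge>0. \<exists>a. (v \<longlongrightarrow> a) (at_right t)) \<and>
     (\<forall>t>0. \<exists>a. (v \<longlongrightarrow> a) (at_left t))"

text \<open>
  Solutions on \<open>[0, \<infinity>)\<close> for an open-loop input \<open>v\<close>: continuous, in the domain of the vector field,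
  and differentiable wherever \<open>v\<close> is continuous. For piecewise continuous \<open>v\<close> this is equivalent to
  the integral equation.
\<close>

definition system_solution ::
  "(real ^ 'n) set \<Rightarrow> ('i::finite \<Rightarrow> 'i list) \<Rightarrow> ('i \<Rightarrow> real ^ 'n \<Rightarrow> (real ^ 'n) list \<Rightarrow> real ^ 'n) \<Rightarrow>
   (real \<Rightarrow> (real ^ 'n) ^ 'i) \<Rightarrow> (real ^ 'n) ^ 'i \<Rightarrow> (real \<Rightarrow> (real ^ 'n) ^ 'i) \<Rightarrow> bool" where
  "system_solution D nbr f v x0 x \<longleftrightarrow>
     x 0 = x0 \<and> continuous_on {0..} x \<and> (\<forall>t\<ge>0. \<forall>i. x t $ i \<in> D) \<and>
     (\<forall>t\<ge>0. continuous (at t within {0..}) v \<longrightarrow>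
        (x has_vector_derivative (\<chi> i. f i (x t $ i) (nbr_states nbr i (x t)) + v t $ i))
          (at t within {0..}))"

definition invariance_assumption ::
  "(real ^ 'n) set \<Rightarrow> ('i::finite \<Rightarrow> 'i list) \<Rightarrow> ('i \<Rightarrow> real ^ 'n \<Rightarrow> (real ^ 'n) list \<Rightarrow> real ^ 'n) \<Rightarrow>
   real \<Rightarrow> bool" where
  "invariance_assumption D nbr f vmax \<longleftrightarrow>
     (\<forall>x0 v. (\<forall>i. x0 $ i \<in> D) \<longrightarrow> piecewise_continuous v \<longrightarrow> (\<forall>t\<ge>0. \<forall>i. norm (v t $ i) \<le> vmax) \<longrightarrow>
        (\<exists>x. system_solution D nbr f v x0 x \<and>
             (\<forall>y. system_solution D nbr f v x0 y \<longrightarrow> (\<forall>t\<ge>0. y t = x t))))"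

text \<open>
  \<open>D\<close> is open wherever this is used, so interiors relative to \<open>D\<close> are interiors, and the closure
  relative to \<open>D\<close> is \<open>closure _ \<inter> D\<close>. Boundedness of the cells is explicit because
  \<^const>\<open>diameter\<close> is meaningless on unbounded sets.
\<close>

definition cell_decomposition :: "(real ^ 'n) set \<Rightarrow> 'l set \<Rightarrow> ('l \<Rightarrow> (real ^ 'n) set) \<Rightarrow> bool" where
  "cell_decomposition D I S \<longleftrightarrow>
     countable I \<and>
     (\<forall>l\<in>I. S l \<noteq> {} \<and> S l \<subseteq> D \<and> connected (S l) \<and> bounded (S l)) \<and>
     bdd_above ((\<lambda>l. diameter (S l)) ` I) \<and>
     (\<forall>l\<in>I. closure (interior (S l)) \<inter> D = S l) \<and>
     (\<forall>l\<in>I. \<forall>l'\<in>I. l \<noteq> l' \<longrightarrow> interior (S l) \<inter> interior (S l') = {}) \<and>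
     (\<Union>l\<in>I. S l) = D"

text \<open>Cell configurations of agent \<open>i\<close> are pairs \<open>(l\<^sub>i, [l\<^sub>j\<^sub>1, \<dots>])\<close>.\<close>

definition cell_configs :: "('i \<Rightarrow> 'i list) \<Rightarrow> 'l set \<Rightarrow> 'i \<Rightarrow> ('l \<times> 'l list) set" where
  "cell_configs nbr I i = I \<times> tuples (length (nbr i)) I"

definition pr :: "('i \<Rightarrow> 'i list) \<Rightarrow> 'i \<Rightarrow> ('i \<Rightarrow> 'l) \<Rightarrow> 'l \<times> 'l list" where
  "pr nbr i l = (l i, map l (nbr i))"

text \<open>
  \<open>horizon K x0 w\<close> is \<open>T(x0, w)\<close> and \<open>feedback K x0 w t x xs\<close> is \<open>k(t, x, xs; x0, w)\<close>; only
  arguments with \<open>0 \<le> t < T(x0, w)\<close> and all states in \<open>D\<close> are ever relevant.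
\<close>

record 'n feedback_law =
  horizon :: "real ^ 'n \<Rightarrow> real ^ 'n \<Rightarrow> ereal"
  feedback :: "real ^ 'n \<Rightarrow> real ^ 'n \<Rightarrow> real \<Rightarrow> real ^ 'n \<Rightarrow> (real ^ 'n) list \<Rightarrow> real ^ 'n"

text \<open>Local Lipschitz continuity on \<open>[0, T) \<times> D ^ (m + 1)\<close>, jointly in time and states.\<close>

definition locally_Lipschitz_feedback ::
  "(real ^ 'n) set \<Rightarrow> nat \<Rightarrow> ereal \<Rightarrow> (real \<Rightarrow> real ^ 'n \<Rightarrow> (real ^ 'n) list \<Rightarrow> real ^ 'n) \<Rightarrow> bool" where
  "locally_Lipschitz_feedback D m T k \<longleftrightarrow>
     (let dom = {(t, x, xs). 0 \<le> t \<and> ereal t < T \<and> x \<in> D \<and> xs \<in> tuples m D};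
          d = (\<lambda>(t, x, xs) (s, y, ys). sqrt ((t - s)\<^sup>2 + (tuple_dist (x # xs) (y # ys))\<^sup>2));
          k' = (\<lambda>(t, x, xs). k t x xs)
      in \<forall>p\<in>dom. \<exists>r>0. \<exists>C. \<forall>q\<in>dom. \<forall>q'\<in>dom.
           d p q < r \<longrightarrow> d p q' < r \<longrightarrow> norm (k' q - k' q') \<le> C * d q q')"

definition property_P ::
  "(real ^ 'n) set \<Rightarrow> ('l \<Rightarrow> (real ^ 'n) set) \<Rightarrow> real \<Rightarrow> real \<Rightarrow> real \<Rightarrow> (real ^ 'n) set \<Rightarrow>
   'l \<times> 'l list \<Rightarrow> 'n feedback_law \<Rightarrow> bool" where
  "property_P D S M vmax dt W c K \<longleftrightarrow>
     (let (li, ls) = c; Rmax = dt * (M + vmax) in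
      \<forall>x0\<in>S li. \<forall>w\<in>W.
        0 < horizon K x0 w \<and>
        locally_Lipschitz_feedback D (length ls) (horizon K x0 w) (feedback K x0 w) \<and>
        (\<forall>t x xs. 0 \<le> t \<and> t \<le> dt \<and> ereal t < horizon K x0 w \<and>
             x \<in> (S li + cball 0 Rmax) \<inter> D \<and>
             length xs = length ls \<and>
             (\<forall>m<length ls. xs ! m \<in> (S (ls ! m) + cball 0 Rmax) \<inter> D) \<longrightarrow>
             norm (feedback K x0 w t x xs) \<le> vmax) \<and>
        ereal dt < horizon K x0 w)"

definition closed_loop_solution ::
  "(real ^ 'n) set \<Rightarrow> ('i::finite \<Rightarrow> 'i list) \<Rightarrow> ('i \<Rightarrow> real ^ 'n \<Rightarrow> (real ^ 'n) list \<Rightarrow> real ^ 'n) \<Rightarrow>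
   real \<Rightarrow> ('i \<Rightarrow> 'n feedback_law) \<Rightarrow> ('i \<Rightarrow> real ^ 'n) \<Rightarrow> (real ^ 'n) ^ 'i \<Rightarrow>
   (real \<Rightarrow> (real ^ 'n) ^ 'i) \<Rightarrow> bool" where
  "closed_loop_solution D nbr f dt K w x0 x \<longleftrightarrow>
     x 0 = x0 \<and>
     (\<forall>t\<in>{0..dt}.
        (\<forall>m. ereal t < horizon (K m) (x0 $ m) (w m) \<and> x t $ m \<in> D) \<and>
        (x has_vector_derivative
           (\<chi> m. f m (x t $ m) (nbr_states nbr m (x t)) +
                  feedback (K m) (x0 $ m) (w m) t (x t $ m) (nbr_states nbr m (x t))))
          (at t within {0..dt}))"

text \<open>
  The families \<open>K\<close>, \<open>w\<close> range over all agents, with their \<open>i\<close>-th members prescribed. The last line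
  says that the closed-loop solution exists on \<open>[0, dt]\<close> and ends in the cell \<open>l'\<close>.
\<close>

definition condition_C ::
  "(real ^ 'n) set \<Rightarrow> ('i::finite \<Rightarrow> 'i list) \<Rightarrow> ('i \<Rightarrow> real ^ 'n \<Rightarrow> (real ^ 'n) list \<Rightarrow> real ^ 'n) \<Rightarrow>
   'l set \<Rightarrow> ('l \<Rightarrow> (real ^ 'n) set) \<Rightarrow> real \<Rightarrow> real \<Rightarrow> real \<Rightarrow> (real ^ 'n) set \<Rightarrow>
   'i \<Rightarrow> 'l \<times> 'l list \<Rightarrow> 'n feedback_law \<Rightarrow> real ^ 'n \<Rightarrow> 'l \<Rightarrow> bool" where
  "condition_C D nbr f I S M vmax dt W i c Ki wi l' \<longleftrightarrow>
     (\<forall>l K w x0.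
        range l \<subseteq> I \<and> pr nbr i l = c \<and> K i = Ki \<and> w i = wi \<and>
        (\<forall>m. m \<noteq> i \<longrightarrow> property_P D S M vmax dt W (pr nbr m l) (K m) \<and> w m \<in> W) \<and>
        (\<forall>m. x0 $ m \<in> S (l m)) \<longrightarrow>
        (\<exists>x. closed_loop_solution D nbr f dt K w x0 x) \<and>
        (\<forall>x. closed_loop_solution D nbr f dt K w x0 x \<longrightarrow> x dt $ i \<in> S l'))"

definition well_posed_transition ::
  "(real ^ 'n) set \<Rightarrow> ('i::finite \<Rightarrow> 'i list) \<Rightarrow> ('i \<Rightarrow> real ^ 'n \<Rightarrow> (real ^ 'n) list \<Rightarrow> real ^ 'n) \<Rightarrow>
   'l set \<Rightarrow> ('l \<Rightarrow> (real ^ 'n) set) \<Rightarrow> real \<Rightarrow> real \<Rightarrow> real \<Rightarrow> (real ^ 'n) set \<Rightarrow>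
   'i \<Rightarrow> 'l \<times> 'l list \<Rightarrow> 'l \<Rightarrow> bool" where
  "well_posed_transition D nbr f I S M vmax dt W i c l' \<longleftrightarrow>
     (\<exists>K :: 'n feedback_law. \<exists>w\<in>W. property_P D S M vmax dt W c K \<and>
        condition_C D nbr f I S M vmax dt W i c K w l')"

text \<open>The first component of \<open>c\<close> is the current cell, so it is not a separate argument.\<close>

definition Post ::
  "(real ^ 'n) set \<Rightarrow> ('i::finite \<Rightarrow> 'i list) \<Rightarrow> ('i \<Rightarrow> real ^ 'n \<Rightarrow> (real ^ 'n) list \<Rightarrow> real ^ 'n) \<Rightarrow>
   'l set \<Rightarrow> ('l \<Rightarrow> (real ^ 'n) set) \<Rightarrow> real \<Rightarrow> real \<Rightarrow> real \<Rightarrow> (real ^ 'n) set \<Rightarrow>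
   'i \<Rightarrow> 'l \<times> 'l list \<Rightarrow> 'l set" where
  "Post D nbr f I S M vmax dt W i c = {l' \<in> I. well_posed_transition D nbr f I S M vmax dt W i c l'}"

end

theory Submission
  imports Defs
begin

text \<open>
  Freeze the neighbors of agent \<open>i\<close> at reference points of their cells and let \<open>\<xi>\<close> be the trajectory
  of the frozen equation from the reference point \<open>p\<close> of its own cell. The feedback compensates the
  motion of the neighbors and the offset \<open>x0 - p\<close>, so that agent \<open>i\<close> ends in \<open>\<xi> dt + dt * w\<close> whatever
  the other agents do. Varying \<open>w\<close>, the reachable end points fill a ball of radius
  \<open>lam * vmax * dt \<ge> mu * dmax / 2\<close>, which is covered by the cells in \<open>Post\<close>. By the isodiametric
  inequality no cell has a larger volume than a ball of radius \<open>dmax / 2\<close>, so at least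
  \<open>mu ^ n\<close> cells are needed.
\<close>

section \<open>The isodiametric inequality by Steiner symmetrization\<close>

lemma long_set_has_distant_points:
  fixes T :: "real set"
  assumes "ennreal m < emeasure lborel T" "0 \<le> m"
  shows "\<exists>a\<in>T. \<exists>b\<in>T. m < b - a"
proof (rule ccontr)
  assume "\<not> ?thesis"
  then have le: "b - a \<le> m" if "a \<in> T" "b \<in> T" for a b
    using that by force
  obtain p where p: "p \<in> T"
    using assms by (cases "T = {}") auto
  have bdd: "bdd_below T"
    using le[OF _ p] by (intro bdd_belowI[of _ "p - m"]) (force simp: algebra_simps)
  have "T \<subseteq> {Inf T .. Inf T + m}"
  proof
    fix b assume b: "b \<in> T"
    have "b - m \<le> Inf T"
      using p le[OF _ b] by (intro cInf_greatest) (auto simp: algebra_simps)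
    then show "b \<in> {Inf T .. Inf T + m}"
      using cInf_lower[OF b bdd] by auto
  qed
  then have "emeasure lborel T \<le> emeasure lborel {Inf T .. Inf T + m}"
    by (intro emeasure_mono) auto
  then show False
    using assms by auto
qed

lemma emeasure_centered_interval: "emeasure lborel {t::real. ennreal (2 * \<bar>t\<bar>) < l} = l"
proof (cases l)
  case (real c)
  then have "{t::real. ennreal (2 * \<bar>t\<bar>) < l} = {- (c / 2) <..< c / 2}"
    by (auto simp: ennreal_less_iff)
  then show ?thesis
    using real by simp
next
  case top
  then show ?thesis by simp
qed

definition slice_length :: "'b \<Rightarrow> ('b \<Rightarrow> real) set \<Rightarrow> ('b \<Rightarrow> real) \<Rightarrow> ennreal" where
  "slice_length i A x = emeasure lborel {t. x(i := t) \<in> A}"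

text \<open>Each slice in direction \<open>i\<close> is replaced by the centered open interval of
  the same length, possibly empty or the whole line. Owing to the strict inequality, every point of
  the new slice is witnessed by two points of the old one more than
  \<open>2 * \<bar>x i\<bar>\<close> apart, so slices need not attain their extremes.\<close>

definition steiner :: "'b set \<Rightarrow> 'b \<Rightarrow> ('b \<Rightarrow> real) set \<Rightarrow> ('b \<Rightarrow> real) set" where
  "steiner J i A = {x \<in> PiE J (\<lambda>_. UNIV). ennreal (2 * \<bar>x i\<bar>) < slice_length i A x}"

definition reflection_invariant :: "'b \<Rightarrow> ('b \<Rightarrow> real) set \<Rightarrow> bool" where
  "reflection_invariant j A \<longleftrightarrow> (\<forall>x\<in>A. x(j := - x j) \<in> A)"

abbreviation sq_dist_le :: "'b set \<Rightarrow> real \<Rightarrow> ('b \<Rightarrow> real) set \<Rightarrow> bool" where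
  "sq_dist_le J d A \<equiv> \<forall>x\<in>A. \<forall>y\<in>A. (\<Sum>j\<in>J. (x j - y j)\<^sup>2) \<le> d\<^sup>2"

lemma slice_length_upd [simp]: "slice_length i A (x(i := s)) = slice_length i A x"
  by (simp add: slice_length_def)

lemma steiner_sets:
  assumes "i \<in> J" "A \<in> sets (PiM J (\<lambda>_. lborel))"
  shows "steiner J i A \<in> sets (PiM J (\<lambda>_. lborel))"
proof -
  let ?P = "PiM J (\<lambda>_. lborel :: real measure)"
  let ?Q = "(\<lambda>(x, t). x(i := t)) -` A \<inter> space (?P \<Otimes>\<^sub>M lborel)"
  \<comment> \<open>Overwriting a coordinate in \<open>J\<close> counts as adding it to a product
    that already has it, so \<open>measurable_add_dim\<close> applies.\<close>
  have ins: "insert i J = J"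
    using assms by auto
  have "(\<lambda>(x, t). x(i := t)) \<in> measurable (?P \<Otimes>\<^sub>M lborel) ?P"
    using measurable_add_dim[of i J "\<lambda>_. lborel :: real measure"] by (simp add: ins)
  then have "?Q \<in> sets (?P \<Otimes>\<^sub>M lborel)"
    using assms(2) by (rule measurable_sets)
  then have "(\<lambda>x. emeasure lborel (Pair x -` ?Q)) \<in> borel_measurable ?P"
    by (rule lborel.measurable_emeasure_Pair)
  moreover have "emeasure lborel (Pair x -` ?Q) = slice_length i A x" if "x \<in> space ?P" for x
    using that by (auto simp: slice_length_def space_pair_measure intro!: arg_cong2[where f=emeasure])
  ultimately have [measurable]: "slice_length i A \<in> borel_measurable ?P"
    by (subst measurable_cong[symmetric]) auto
  have [measurable]: "(\<lambda>x. x i) \<in> borel_measurable ?P"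
    using measurable_component_singleton[of i J "\<lambda>_. lborel :: real measure"] assms by simp
  have "{x \<in> space ?P. ennreal (2 * \<bar>x i\<bar>) < slice_length i A x} \<in> sets ?P"
    by measurable
  then show ?thesis
    by (simp add: steiner_def space_PiM)
qed

lemma emeasure_eq_integral_slice_length:
  assumes "finite J" "i \<in> J" "A \<in> sets (PiM J (\<lambda>_. lborel))"
  shows "emeasure (PiM J (\<lambda>_. lborel)) A
       = (\<integral>\<^sup>+x. slice_length i A x \<partial>PiM (J - {i}) (\<lambda>_. lborel))"
proof -
  interpret product_sigma_finite "\<lambda>_::'a. lborel :: real measure"
    by standard
  have J: "J = insert i (J - {i})"
    using assms by auto
  have [measurable]: "A \<in> sets (PiM (insert i (J - {i})) (\<lambda>_. lborel))"
    using assms J by simp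
  have "emeasure (PiM J (\<lambda>_. lborel)) A
      = (\<integral>\<^sup>+x. indicator A x \<partial>PiM (insert i (J - {i})) (\<lambda>_. lborel))"
    unfolding J[symmetric] using assms by simp
  also have "\<dots> = (\<integral>\<^sup>+x. (\<integral>\<^sup>+t. indicator A (x(i := t)) \<partial>lborel) \<partial>PiM (J - {i}) (\<lambda>_. lborel))"
    using assms by (intro product_nn_integral_insert borel_measurable_indicator) (auto simp: insert_absorb)
  also have "\<dots> = (\<integral>\<^sup>+x. slice_length i A x \<partial>PiM (J - {i}) (\<lambda>_. lborel))"
  proof (intro nn_integral_cong)
    fix x assume x: "x \<in> space (PiM (J - {i}) (\<lambda>_. lborel :: real measure))"
    have "(\<lambda>t. x(i := t)) \<in> measurable lborel (PiM (insert i (J - {i})) (\<lambda>_. lborel))"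
      using measurable_comp[OF measurable_Pair1'[OF x]
          measurable_add_dim[of i "J - {i}" "\<lambda>_. lborel :: real measure"]]
      by (simp add: comp_def)
    then have "(\<lambda>t. x(i := t)) -` A \<inter> space lborel \<in> sets lborel"
      by (rule measurable_sets) measurable
    then have "{t. x(i := t) \<in> A} \<in> sets lborel"
      by (simp add: vimage_def)
    moreover have "indicator A (x(i := t)) = (indicator {t. x(i := t) \<in> A} t :: ennreal)" for t
      by (auto simp: indicator_def)
    ultimately show "(\<integral>\<^sup>+t. indicator A (x(i := t)) \<partial>lborel) = slice_length i A x"
      by (simp add: slice_length_def)
  qed
  finally show ?thesis .
qed

text \<open>Cavalieri's principle: the length of every slice in direction \<open>i\<close> is kept,
  and the measure is the integral of these lengths.\<close>

lemma emeasure_steiner: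
  assumes "finite J" "i \<in> J" "A \<in> sets (PiM J (\<lambda>_. lborel))"
  shows "emeasure (PiM J (\<lambda>_. lborel)) (steiner J i A) = emeasure (PiM J (\<lambda>_. lborel)) A"
proof -
  have "slice_length i (steiner J i A) x = slice_length i A x"
    if "x \<in> space (PiM (J - {i}) (\<lambda>_. lborel :: real measure))" for x
  proof -
    have "x(i := t) \<in> PiE J (\<lambda>_. UNIV)" for t
      using that assms by (auto simp: space_PiM PiE_def extensional_def)
    then have "{t. x(i := t) \<in> steiner J i A} = {t. ennreal (2 * \<bar>t\<bar>) < slice_length i A x}"
      by (simp add: steiner_def)
    then have "slice_length i (steiner J i A) x
             = emeasure lborel {t::real. ennreal (2 * \<bar>t\<bar>) < slice_length i A x}"
      unfolding slice_length_def[of i "steiner J i A"] by simp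
    then show ?thesis
      by (simp only: emeasure_centered_interval)
  qed
  then show ?thesis
    unfolding emeasure_eq_integral_slice_length[OF assms]
      emeasure_eq_integral_slice_length[OF assms(1,2) steiner_sets[OF assms(2,3)]]
    by (intro nn_integral_cong) auto
qed

lemma sq_dist_le_steiner:
  assumes "finite J" "i \<in> J" and A: "sq_dist_le J d A"
  shows "sq_dist_le J d (steiner J i A)"
proof (intro ballI)
  have split: "(\<Sum>j\<in>J. (x j - y j)\<^sup>2) = (x i - y i)\<^sup>2 + (\<Sum>j\<in>J - {i}. (x j - y j)\<^sup>2)"
    for x y :: "'a \<Rightarrow> real"
    using assms by (subst sum.remove[of J i]) auto
  fix x y assume "x \<in> steiner J i A" "y \<in> steiner J i A"
  then have "ennreal (2 * \<bar>x i\<bar>) < emeasure lborel {t. x(i := t) \<in> A}"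
    "ennreal (2 * \<bar>y i\<bar>) < emeasure lborel {t. y(i := t) \<in> A}"
    by (auto simp: steiner_def slice_length_def)
  then have "\<exists>a\<in>{t. x(i := t) \<in> A}. \<exists>b\<in>{t. x(i := t) \<in> A}. 2 * \<bar>x i\<bar> < b - a"
    "\<exists>c\<in>{t. y(i := t) \<in> A}. \<exists>e\<in>{t. y(i := t) \<in> A}. 2 * \<bar>y i\<bar> < e - c"
    by (simp_all only: long_set_has_distant_points mult_nonneg_nonneg abs_ge_zero zero_le_numeral)
  then obtain a b c e where
    A': "x(i := a) \<in> A" "x(i := b) \<in> A" "y(i := c) \<in> A" "y(i := e) \<in> A"
    and len: "2 * \<bar>x i\<bar> < b - a" "2 * \<bar>y i\<bar> < e - c"
    by blast
  \<comment> \<open>The crossing differences satisfy \<open>(b - c) + (e - a) > 2 * \<bar>x i\<bar>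
    + 2 * \<bar>y i\<bar>\<close>, so one of them is at least
    \<open>\<bar>x i\<bar> + \<bar>y i\<bar>\<close>. Using that pair as \<open>i\<close>-th
    coordinates leads back to two points of \<open>A\<close>.\<close>
  have "\<bar>x i - y i\<bar> \<le> \<bar>b - c\<bar> \<or> \<bar>x i - y i\<bar> \<le> \<bar>a - e\<bar>"
    using len by linarith
  then obtain s u where su: "x(i := s) \<in> A" "y(i := u) \<in> A" "\<bar>x i - y i\<bar> \<le> \<bar>s - u\<bar>"
    using A' by blast
  have "(\<Sum>j\<in>J. (x j - y j)\<^sup>2) \<le> (s - u)\<^sup>2 + (\<Sum>j\<in>J - {i}. (x j - y j)\<^sup>2)"
    using su(3) by (auto simp: split abs_le_square_iff)
  also have "\<dots> = (\<Sum>j\<in>J. ((x(i := s)) j - (y(i := u)) j)\<^sup>2)"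
    by (simp add: split)
  also have "\<dots> \<le> d\<^sup>2"
    using A su by blast
  finally show "(\<Sum>j\<in>J. (x j - y j)\<^sup>2) \<le> d\<^sup>2" .
qed

lemma reflection_invariant_steiner_self:
  assumes "i \<in> J"
  shows "reflection_invariant i (steiner J i A)"
  using assms by (auto simp: reflection_invariant_def steiner_def PiE_def extensional_def)

text \<open>The slices of \<open>A\<close> in direction \<open>i\<close> through \<open>x\<close>
  and through its reflection in direction \<open>j\<close> coincide. Hence a later symmetrization
  does not destroy the symmetries gained before.\<close>

lemma reflection_invariant_steiner:
  assumes "i \<in> J" "j \<in> J" "i \<noteq> j" and A: "reflection_invariant j A"
  shows "reflection_invariant j (steiner J i A)"
proof -
  have "x(j := - x j, i := t) \<in> A \<longleftrightarrow> x(i := t) \<in> A" for x t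
  proof
    assume "x(i := t) \<in> A"
    then have "(x(i := t))(j := - (x(i := t)) j) \<in> A"
      using A unfolding reflection_invariant_def by blast
    then show "x(j := - x j, i := t) \<in> A"
      using assms by (simp add: fun_upd_twist)
  next
    let ?y = "x(j := - x j, i := t)"
    assume "?y \<in> A"
    then have "?y(j := - ?y j) \<in> A"
      using A unfolding reflection_invariant_def by blast
    moreover have "?y(j := - ?y j) = x(i := t)"
      using assms(3) by auto
    ultimately show "x(i := t) \<in> A"
      by simp
  qed
  then have "slice_length i A (x(j := - x j)) = slice_length i A x" for x
    by (simp add: slice_length_def)
  then show ?thesis
    using assms by (auto simp: reflection_invariant_def steiner_def PiE_def extensional_def)
qed

lemma exists_symmetrization:
  assumes "finite J" "K \<subseteq> J" "A \<in> sets (PiM J (\<lambda>_. lborel))" "sq_dist_le J d A"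
  shows "\<exists>A'\<in>sets (PiM J (\<lambda>_. lborel)).
           emeasure (PiM J (\<lambda>_. lborel)) A' = emeasure (PiM J (\<lambda>_. lborel)) A \<and>
           sq_dist_le J d A' \<and> (\<forall>j\<in>K. reflection_invariant j A')"
  using finite_subset[OF assms(2,1)] assms(2)
proof induction
  case empty
  then show ?case
    using assms by blast
next
  case (insert i K)
  then obtain A' where A': "A' \<in> sets (PiM J (\<lambda>_. lborel))"
    "emeasure (PiM J (\<lambda>_. lborel)) A' = emeasure (PiM J (\<lambda>_. lborel)) A"
    "sq_dist_le J d A'" "\<forall>j\<in>K. reflection_invariant j A'"
    by auto
  have i: "i \<in> J"
    using insert by auto
  show ?case
  proof (intro bexI[of _ "steiner J i A'"] conjI)
    show "\<forall>j\<in>insert i K. reflection_invariant j (steiner J i A')"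
      using insert A' i
      by (auto intro!: reflection_invariant_steiner_self reflection_invariant_steiner)
    show "steiner J i A' \<in> sets (PiM J (\<lambda>_. lborel))"
      using i A'(1) by (rule steiner_sets)
    show "emeasure (PiM J (\<lambda>_. lborel)) (steiner J i A') = emeasure (PiM J (\<lambda>_. lborel)) A"
      using emeasure_steiner[OF assms(1) i A'(1)] A'(2) by simp
    show "sq_dist_le J d (steiner J i A')"
      using assms(1) i A'(3) by (rule sq_dist_le_steiner)
  qed
qed

text \<open>A set of diameter \<open>d\<close> need not fit into a ball of radius
  \<open>d / 2\<close>. Once it is symmetric in every coordinate it contains \<open>- x\<close>
  along with \<open>x\<close>, and their distance, twice the norm of \<open>x\<close>, is at most
  \<open>d\<close>.\<close>

lemma emeasure_PiM_le_ball:
  assumes "finite J" "A \<in> sets (PiM J (\<lambda>_. lborel))" "sq_dist_le J d A" "0 < d"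
  shows "emeasure (PiM J (\<lambda>_. lborel)) A \<le> ennreal (unit_ball_vol (card J) * (d / 2) ^ card J)"
proof -
  obtain A' where A': "A' \<in> sets (PiM J (\<lambda>_. lborel))"
    "emeasure (PiM J (\<lambda>_. lborel)) A' = emeasure (PiM J (\<lambda>_. lborel)) A"
    "sq_dist_le J d A'" "\<forall>j\<in>J. reflection_invariant j A'"
    using exists_symmetrization[OF assms(1) subset_refl assms(2,3)] by blast
  \<comment> \<open>Points of the product are extensional functions, so only coordinates in
    \<open>J\<close> may be flipped and the default value outside \<open>J\<close> stays
    untouched.\<close>
  have refl: "(\<lambda>j. if j \<in> K then - x j else x j) \<in> A'" if "K \<subseteq> J" "x \<in> A'" for K x
    using finite_subset[OF that(1) assms(1)] that(1)
  proof induction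
    case empty
    then show ?case using that by simp
  next
    case (insert i K)
    let ?y = "\<lambda>j. if j \<in> K then - x j else x j"
    have "?y(i := - ?y i) \<in> A'"
      using insert A'(4) unfolding reflection_invariant_def by blast
    moreover have "?y(i := - ?y i) = (\<lambda>j. if j \<in> insert i K then - x j else x j)"
      using insert by auto
    ultimately show ?case by simp
  qed
  have "A' \<subseteq> {x. sqrt (\<Sum>j\<in>J. (x j)\<^sup>2) \<le> d / 2} \<inter> space (PiM J (\<lambda>_. lborel))"
  proof
    fix x assume x: "x \<in> A'"
    have "(\<Sum>j\<in>J. (x j - (if j \<in> J then - x j else x j))\<^sup>2) \<le> d\<^sup>2"
      using bspec[OF bspec[OF A'(3) x] refl[OF subset_refl x]] by simp
    also have "(\<Sum>j\<in>J. (x j - (if j \<in> J then - x j else x j))\<^sup>2) = 4 * (\<Sum>j\<in>J. (x j)\<^sup>2)"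
      by (subst sum_distrib_left, intro sum.cong) (auto simp: power2_eq_square)
    finally have "(\<Sum>j\<in>J. (x j)\<^sup>2) \<le> (d / 2)\<^sup>2"
      by (simp add: power2_eq_square)
    then have "sqrt (\<Sum>j\<in>J. (x j)\<^sup>2) \<le> d / 2"
      using assms by (intro real_le_lsqrt) auto
    then show "x \<in> {x. sqrt (\<Sum>j\<in>J. (x j)\<^sup>2) \<le> d / 2} \<inter> space (PiM J (\<lambda>_. lborel))"
      using x sets.sets_into_space[OF A'(1)] by auto
  qed
  then have "emeasure (PiM J (\<lambda>_. lborel)) A'
      \<le> emeasure (PiM J (\<lambda>_. lborel)) ({x. sqrt (\<Sum>j\<in>J. (x j)\<^sup>2) \<le> d / 2} \<inter> space (PiM J (\<lambda>_. lborel)))"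
  proof (rule emeasure_mono)
    have "(\<lambda>x. sqrt (\<Sum>j\<in>J. (x j)\<^sup>2)) \<in> borel_measurable (PiM J (\<lambda>_. lborel))"
      by measurable
    then have "(\<lambda>x. sqrt (\<Sum>j\<in>J. (x j)\<^sup>2)) -` {..d / 2} \<inter> space (PiM J (\<lambda>_. lborel))
        \<in> sets (PiM J (\<lambda>_. lborel :: real measure))"
      by (rule measurable_sets) auto
    then show "{x. sqrt (\<Sum>j\<in>J. (x j)\<^sup>2) \<le> d / 2} \<inter> space (PiM J (\<lambda>_. lborel))
        \<in> sets (PiM J (\<lambda>_. lborel :: real measure))"
      by (simp add: vimage_def)
  qed
  also have "\<dots> = ennreal (unit_ball_vol (card J) * (d / 2) ^ card J)"
    using assms by (intro emeasure_cball_aux) auto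
  finally show ?thesis
    by (simp add: A')
qed

theorem isodiametric:
  fixes A :: "'a::euclidean_space set"
  assumes "A \<in> sets borel" "\<And>x y. x \<in> A \<Longrightarrow> y \<in> A \<Longrightarrow> dist x y \<le> d" "0 < d"
  shows "emeasure lborel A \<le> emeasure lborel (cball (0::'a) (d / 2))"
proof -
  let ?P = "PiM Basis (\<lambda>_. lborel :: real measure)"
  let ?h = "\<lambda>f. \<Sum>b\<in>Basis. f b *\<^sub>R (b::'a)"
  have h: "?h \<in> measurable ?P borel"
    by measurable
  have "emeasure lborel A = emeasure (distr ?P borel ?h) A"
    unfolding lborel_eq[where 'a='a] ..
  also have "\<dots> = emeasure ?P (?h -` A \<inter> space ?P)"
    using h assms(1) by (rule emeasure_distr)
  also have "\<dots> \<le> ennreal (unit_ball_vol (card (Basis :: 'a set)) * (d / 2) ^ card (Basis :: 'a set))"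
  proof (rule emeasure_PiM_le_ball)
    show "sq_dist_le Basis d (?h -` A \<inter> space ?P)"
    proof (intro ballI)
      fix x y assume "x \<in> ?h -` A \<inter> space ?P" "y \<in> ?h -` A \<inter> space ?P"
      then have "dist (?h x) (?h y) \<le> d"
        using assms by auto
      moreover have "(dist (?h x) (?h y))\<^sup>2 = (\<Sum>j\<in>Basis. (x j - y j)\<^sup>2)"
        unfolding euclidean_dist_l2[of "?h x"] L2_set_def
        by (simp add: dist_real_def sum_nonneg)
      ultimately show "(\<Sum>j\<in>Basis. (x j - y j)\<^sup>2) \<le> d\<^sup>2"
        using power_mono[of "dist (?h x) (?h y)" d 2] by simp
    qed
    show "?h -` A \<inter> space ?P \<in> sets ?P"
      using h assms(1) by (rule measurable_sets)
  qed (use assms in auto)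
  also have "\<dots> = emeasure lborel (cball (0::'a) (d / 2))"
    using assms(3) emeasure_cball[of "d / 2" "0::'a"] by simp
  finally show ?thesis .
qed

section \<open>Closed-loop solutions of controlled systems\<close>

lemma has_derivative_weighted_norm_sq:
  fixes z :: "real \<Rightarrow> 'a::real_inner"
  assumes "(z has_vector_derivative z') (at t within S)"
  shows "((\<lambda>t. exp (k * t) * (z t \<bullet> z t)) has_real_derivative
           exp (k * t) * (2 * (z t \<bullet> z') + k * (z t \<bullet> z t))) (at t within S)"
proof -
  have "((\<lambda>t. z t \<bullet> z t) has_real_derivative 2 * (z t \<bullet> z')) (at t within S)"
    using assms unfolding has_vector_derivative_def has_field_derivative_def
    by (auto intro!: derivative_eq_intros simp: inner_commute algebra_simps)
  then show ?thesis
    by (auto intro!: derivative_eq_intros simp: algebra_simps)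
qed

lemma at_most_initial_value:
  fixes q :: "real \<Rightarrow> real"
  assumes "\<And>t. t \<in> {0..T} \<Longrightarrow> (q has_real_derivative q' t) (at t within {0..T})"
    "\<And>t. t \<in> {0..T} \<Longrightarrow> q' t \<le> 0" "t \<in> {0..T}"
  shows "q t \<le> q 0"
proof -
  have 1: "\<exists>y. DERIV q x :> y \<and> y \<le> 0" if x: "0 < x" "x < t" for x
  proof -
    have "at x within {0..T} = at x"
      using x assms(3) by (intro at_within_Icc_at) auto
    moreover have "x \<in> {0..T}"
      using x assms(3) by simp
    ultimately show ?thesis
      using assms(1,2) by metis
  qed
  have 2: "continuous_on {0..t} q"
  proof (rule DERIV_continuous_on)
    fix x assume "x \<in> {0..t}"
    then show "(q has_real_derivative q' x) (at x within {0..t})"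
      using assms(3) by (intro DERIV_subset[OF assms(1)]) auto
  qed
  show ?thesis
    using assms(3) by (intro DERIV_nonpos_imp_decreasing_open[OF _ 1 2]) auto
qed

lemma dist_le_speed:
  fixes z :: "real \<Rightarrow> 'a::real_normed_vector"
  assumes "\<And>s. s \<in> {0..T} \<Longrightarrow> (z has_vector_derivative z' s) (at s within {0..T})"
    and bound: "\<And>s. s \<in> {0..T} \<Longrightarrow> norm (z' s) \<le> B"
    and "s \<in> {0..T}" "t \<in> {0..T}"
  shows "dist (z s) (z t) \<le> B * dist s t"
proof -
  have "norm (z s - z t) \<le> B * norm (s - t)"
  proof (rule differentiable_bound[where S = "{0..T}" and f' = "\<lambda>s h. h *\<^sub>R z' s"])
    fix s assume s: "s \<in> {0..T}"
    show "(z has_derivative (\<lambda>h. h *\<^sub>R z' s)) (at s within {0..T})"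
      using assms(1)[OF s] by (simp add: has_vector_derivative_def)
    have "norm (h *\<^sub>R z' s) \<le> B * norm h" for h :: real
      using mult_right_mono[OF bound[OF s], of "\<bar>h\<bar>"] by (simp add: mult.commute[of "\<bar>h\<bar>"])
    then show "onorm (\<lambda>h. h *\<^sub>R z' s) \<le> B"
      by (rule onorm_le)
  qed (use assms in auto)
  then show ?thesis
    by (simp add: dist_norm)
qed

text \<open>The weighted squared norm minus \<open>d * exp (b * t) / b\<close> is nonincreasing. The
  forcing outgrows \<open>exp (k * t)\<close> at the rate \<open>b\<close>; integrating this surplus
  gives the factor \<open>1 / b\<close>, which a large \<open>b\<close> makes small.\<close>

lemma gronwall_norm_sq:
  fixes z :: "real \<Rightarrow> 'a::real_inner"
  assumes z: "\<And>t. t \<in> {0..T} \<Longrightarrow> (z has_vector_derivative z' t) (at t within {0..T})"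
    and le: "\<And>t. t \<in> {0..T} \<Longrightarrow> 2 * (z t \<bullet> z' t) \<le> k * (z t \<bullet> z t) + d * exp ((k + b) * t)"
    and "0 < b" "t \<in> {0..T}"
  shows "exp (- k * t) * (z t \<bullet> z t) \<le> z 0 \<bullet> z 0 + d * (exp (b * t) - 1) / b"
proof -
  define q where "q = (\<lambda>t. exp (- k * t) * (z t \<bullet> z t) - d * exp (b * t) / b)"
  have "q t \<le> q 0"
  proof (rule at_most_initial_value)
    fix t assume t: "t \<in> {0..T}"
    show "(q has_real_derivative
             exp (- k * t) * (2 * (z t \<bullet> z' t) + - k * (z t \<bullet> z t)) - d * exp (b * t)) (at t within {0..T})"
      unfolding q_def
      by (rule DERIV_diff has_derivative_weighted_norm_sq z t)+
        (use \<open>0 < b\<close> in \<open>auto intro!: derivative_eq_intros\<close>)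
    have "exp (- k * t) * (2 * (z t \<bullet> z' t) + - k * (z t \<bullet> z t))
        \<le> exp (- k * t) * (d * exp ((k + b) * t))"
      using le[OF t] by (intro mult_left_mono) auto
    also have "\<dots> = d * exp (b * t)"
      by (simp flip: exp_add add: algebra_simps)
    finally show "exp (- k * t) * (2 * (z t \<bullet> z' t) + - k * (z t \<bullet> z t)) - d * exp (b * t) \<le> 0"
      by simp
  qed fact
  then show ?thesis
    by (simp add: q_def diff_divide_distrib right_diff_distrib)
qed

lemma gronwall_upper:
  fixes z :: "real \<Rightarrow> 'a::real_inner"
  assumes z: "\<And>t. t \<in> {0..T} \<Longrightarrow> (z has_vector_derivative z' t) (at t within {0..T})"
    and le: "\<And>t. t \<in> {0..T} \<Longrightarrow> norm (z' t) \<le> C * norm (z t)"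
    and "t \<in> {0..T}"
  shows "norm (z t) \<le> exp (C * t) * norm (z 0)"
proof -
  have "exp (- (2 * C) * t) * (z t \<bullet> z t) \<le> z 0 \<bullet> z 0 + 0 * (exp (1 * t) - 1) / 1"
  proof (rule gronwall_norm_sq[OF z])
    fix t assume t: "t \<in> {0..T}"
    have "z t \<bullet> z' t \<le> norm (z t) * norm (z' t)"
      by (rule norm_cauchy_schwarz)
    also have "\<dots> \<le> norm (z t) * (C * norm (z t))"
      using le[OF t] by (intro mult_left_mono) auto
    finally show "2 * (z t \<bullet> z' t) \<le> 2 * C * (z t \<bullet> z t) + 0 * exp ((2 * C + 1) * t)"
      by (simp add: power2_norm_eq_inner[symmetric] power2_eq_square mult.left_commute)
  qed (use assms in auto)
  then have "(exp (- (C * t)) * norm (z t))\<^sup>2 \<le> (norm (z 0))\<^sup>2"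
    by (simp add: power_mult_distrib power2_norm_eq_inner exp_double[symmetric] mult.assoc)
  then have "exp (- (C * t)) * norm (z t) \<le> norm (z 0)"
    by (rule power2_le_imp_le) simp
  then show ?thesis
    by (simp add: exp_minus field_simps)
qed

text \<open>A linear bound on the derivative limits decay as well as growth: with the weight
  \<open>exp (2 * C * t)\<close> the squared norm cannot decrease. This makes flow maps injective
  and bounds how much they contract.\<close>

lemma gronwall_lower:
  fixes z :: "real \<Rightarrow> 'a::real_inner"
  assumes z: "\<And>t. t \<in> {0..T} \<Longrightarrow> (z has_vector_derivative z' t) (at t within {0..T})"
    and le: "\<And>t. t \<in> {0..T} \<Longrightarrow> norm (z' t) \<le> C * norm (z t)"
    and "t \<in> {0..T}"
  shows "exp (- C * t) * norm (z 0) \<le> norm (z t)"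
proof -
  let ?q' = "\<lambda>t. exp (2 * C * t) * (2 * (z t \<bullet> z' t) + 2 * C * (z t \<bullet> z t))"
  have "- (exp (2 * C * t) * (z t \<bullet> z t)) \<le> - (exp (2 * C * 0) * (z 0 \<bullet> z 0))"
  proof (rule at_most_initial_value[where q' = "\<lambda>t. - ?q' t"])
    fix t assume t: "t \<in> {0..T}"
    show "((\<lambda>t. - (exp (2 * C * t) * (z t \<bullet> z t))) has_real_derivative - ?q' t) (at t within {0..T})"
      by (intro DERIV_minus has_derivative_weighted_norm_sq z t)
    have "\<bar>z t \<bullet> z' t\<bar> \<le> norm (z t) * norm (z' t)"
      by (rule Cauchy_Schwarz_ineq2)
    also have "\<dots> \<le> norm (z t) * (C * norm (z t))"
      using le[OF t] by (intro mult_left_mono) auto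
    finally have "0 \<le> z t \<bullet> z' t + C * (z t \<bullet> z t)"
      by (simp add: power2_norm_eq_inner[symmetric] power2_eq_square mult.left_commute)
    then have "0 \<le> exp (2 * C * t) * (2 * (z t \<bullet> z' t + C * (z t \<bullet> z t)))"
      by (intro mult_nonneg_nonneg) auto
    then show "- ?q' t \<le> 0"
      by (simp add: algebra_simps)
  qed fact
  then have "(norm (z 0))\<^sup>2 \<le> (exp (C * t) * norm (z t))\<^sup>2"
    by (simp add: power_mult_distrib power2_norm_eq_inner exp_double[symmetric] mult.assoc)
  then have "norm (z 0) \<le> exp (C * t) * norm (z t)"
    by (rule power2_le_imp_le) simp
  then show ?thesis
    by (simp add: exp_minus field_simps)
qed

text \<open>By \<open>2 * u * v \<le> u^2 + v^2\<close> the input becomes a squared forcing, at the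
  price of \<open>1\<close> in the rate \<open>2 * C + 1\<close>; hence the summand
  \<open>1 / 2\<close> in the exponent. The factor \<open>1 / sqrt b\<close> will turn a Lipschitz
  map into a contraction.\<close>

lemma gronwall_input:
  fixes z :: "real \<Rightarrow> 'a::real_inner"
  assumes z: "\<And>t. t \<in> {0..T} \<Longrightarrow> (z has_vector_derivative z' t) (at t within {0..T})"
    and le: "\<And>t. t \<in> {0..T} \<Longrightarrow> norm (z' t) \<le> C * norm (z t) + d * exp ((C + 1 / 2 + b / 2) * t)"
    and "z 0 = 0" "0 < b" "t \<in> {0..T}" "0 \<le> d"
  shows "norm (z t) \<le> d / sqrt b * exp ((C + 1 / 2 + b / 2) * t)"
proof -
  define a where "a = C + 1 / 2 + b / 2"
  define k where "k = 2 * C + 1"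
  have "exp (- (2 * C + 1) * t) * (z t \<bullet> z t) \<le> z 0 \<bullet> z 0 + d\<^sup>2 * (exp (b * t) - 1) / b"
  proof (rule gronwall_norm_sq[OF z])
    fix t assume t: "t \<in> {0..T}"
    have "z t \<bullet> z' t \<le> norm (z t) * norm (z' t)"
      by (rule norm_cauchy_schwarz)
    also have "\<dots> \<le> norm (z t) * (C * norm (z t) + d * exp (a * t))"
      using le[OF t] by (intro mult_left_mono) (auto simp: a_def)
    also have "\<dots> = C * (norm (z t))\<^sup>2 + norm (z t) * (d * exp (a * t))"
      by (simp add: algebra_simps power2_eq_square)
    finally have "2 * (z t \<bullet> z' t) \<le> 2 * C * (norm (z t))\<^sup>2 + 2 * norm (z t) * (d * exp (a * t))"
      by simp
    also have "\<dots> \<le> 2 * C * (norm (z t))\<^sup>2 + ((norm (z t))\<^sup>2 + (d * exp (a * t))\<^sup>2)"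
      by (intro add_left_mono sum_squares_bound)
    also have "(d * exp (a * t))\<^sup>2 = d\<^sup>2 * exp ((2 * C + 1 + b) * t)"
      by (simp add: power_mult_distrib exp_double[symmetric] a_def algebra_simps)
    finally show "2 * (z t \<bullet> z' t) \<le> (2 * C + 1) * (z t \<bullet> z t) + d\<^sup>2 * exp ((2 * C + 1 + b) * t)"
      by (simp add: power2_norm_eq_inner algebra_simps)
  qed (use assms in auto)
  also have "\<dots> \<le> d\<^sup>2 * exp (b * t) / b"
    using assms by (auto simp: divide_right_mono mult_left_mono)
  finally have "exp (- k * t) * (z t \<bullet> z t) \<le> d\<^sup>2 * exp (b * t) / b"
    by (simp add: k_def)
  then have "exp (k * t) * (exp (- k * t) * (z t \<bullet> z t)) \<le> exp (k * t) * (d\<^sup>2 * exp (b * t) / b)"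
    by (intro mult_left_mono) auto
  moreover have "exp (k * t) * (exp (- k * t) * (z t \<bullet> z t)) = (norm (z t))\<^sup>2"
    by (simp add: power2_norm_eq_inner exp_minus)
  moreover have "exp (k * t) * (d\<^sup>2 * exp (b * t) / b) = (d / sqrt b * exp (a * t))\<^sup>2"
  proof -
    have "exp (k * t) * exp (b * t) = (exp (a * t))\<^sup>2"
      by (simp add: exp_double[symmetric] a_def k_def algebra_simps flip: exp_add)
    then show ?thesis
      using \<open>0 < b\<close> by (simp add: power_mult_distrib power_divide)
  qed
  ultimately have "(norm (z t))\<^sup>2 \<le> (d / sqrt b * exp (a * t))\<^sup>2"
    by simp
  then show ?thesis
    unfolding a_def[symmetric] by (rule power2_le_imp_le) (use assms in auto)
qed

text \<open>
  \<open>U\<close> is the joint state space and \<open>V\<close> the set of admissible input values.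
\<close>

locale controlled_system =
  fixes U :: "'a::euclidean_space set" and F :: "'a \<Rightarrow> 'a" and V :: "'a set" and C B :: real
  assumes open_U: "open U"
    and lipschitz: "C-lipschitz_on U F"
    and F_bound: "\<And>x. x \<in> U \<Longrightarrow> norm (F x) \<le> B"
    and V: "compact V" "V \<noteq> {}"
    and invariant: "\<And>a v. a \<in> U \<Longrightarrow> continuous_on UNIV v \<Longrightarrow> range v \<subseteq> V \<Longrightarrow>
      \<exists>x. x 0 = a \<and> (\<forall>t\<ge>0. x t \<in> U \<and> (x has_vector_derivative F (x t) + v t) (at t within {0..}))"
begin

definition solution :: "(real \<Rightarrow> 'a) \<Rightarrow> 'a \<Rightarrow> (real \<Rightarrow> 'a) \<Rightarrow> bool" where
  "solution v a x \<longleftrightarrow> x 0 = a \<and>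
     (\<forall>t\<ge>0. x t \<in> U \<and> (x has_vector_derivative F (x t) + v t) (at t within {0..}))"

definition admissible :: "(real \<Rightarrow> 'a) set" where
  "admissible = {v. continuous_on UNIV v \<and> range v \<subseteq> V}"

lemma solution_deriv:
  assumes "solution v a x" "t \<in> {0..T}"
  shows "(x has_vector_derivative F (x t) + v t) (at t within {0..T})"
  using assms by (auto simp: solution_def intro: has_vector_derivative_within_subset)

lemma solution_diff_deriv:
  assumes "solution v a x" "solution w b y" "t \<in> {0..T}"
  shows "((\<lambda>t. x t - y t) has_vector_derivative F (x t) - F (y t) + (v t - w t)) (at t within {0..T})"
  using has_vector_derivative_diff[OF assms(1,2)[THEN solution_deriv[OF _ assms(3)]]]
  by (simp add: algebra_simps)

lemma F_diff_bound:
  assumes "solution v a x" "solution w b y" "0 \<le> t"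
  shows "norm (F (x t) - F (y t)) \<le> C * norm (x t - y t)"
  using lipschitz_onD[OF lipschitz] assms by (simp add: solution_def dist_norm)

lemma C_nonneg: "0 \<le> C"
  using lipschitz by (rule lipschitz_on_nonneg)

lemma solution_dist:
  assumes "solution v a x" "solution v b y" "0 \<le> t"
  shows "exp (- C * t) * dist a b \<le> dist (x t) (y t)"
    and "dist (x t) (y t) \<le> exp (C * t) * dist a b"
proof -
  have 0: "x 0 = a" "y 0 = b"
    using assms by (auto simp: solution_def)
  have d: "((\<lambda>t. x t - y t) has_vector_derivative F (x s) - F (y s)) (at s within {0..t})"
    "norm (F (x s) - F (y s)) \<le> C * norm (x s - y s)" if "s \<in> {0..t}" for s
    using solution_diff_deriv[OF assms(1,2) that] F_diff_bound[OF assms(1,2)] that by auto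
  show "exp (- C * t) * dist a b \<le> dist (x t) (y t)"
    using gronwall_lower[OF d, of t] \<open>0 \<le> t\<close> by (simp add: 0 dist_norm)
  show "dist (x t) (y t) \<le> exp (C * t) * dist a b"
    using gronwall_upper[OF d, of t] \<open>0 \<le> t\<close> by (simp add: 0 dist_norm)
qed

lemma solution_unique:
  assumes "solution v a x" "solution v a y" "0 \<le> t"
  shows "x t = y t"
  using solution_dist(2)[OF assms] by simp

lemma solution_input_dist:
  assumes "solution v a x" "solution w a y" "0 < b" "0 \<le> d" "t \<in> {0..T}"
    and "\<And>s. s \<in> {0..T} \<Longrightarrow> norm (v s - w s) \<le> d * exp ((C + 1 / 2 + b / 2) * s)"
  shows "norm (x t - y t) \<le> d / sqrt b * exp ((C + 1 / 2 + b / 2) * t)"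
proof (rule gronwall_input)
  fix s assume s: "s \<in> {0..T}"
  show "((\<lambda>t. x t - y t) has_vector_derivative F (x s) - F (y s) + (v s - w s)) (at s within {0..T})"
    using assms(1,2) s by (rule solution_diff_deriv)
  show "norm (F (x s) - F (y s) + (v s - w s)) \<le> C * norm (x s - y s) + d * exp ((C + 1 / 2 + b / 2) * s)"
    using F_diff_bound[OF assms(1,2), of s] assms(6)[OF s] s
    by (intro norm_triangle_le add_mono) auto
qed (use assms(1-5) in \<open>simp_all add: solution_def\<close>)

lemma exists_solution:
  assumes "v \<in> admissible" "a \<in> U"
  shows "\<exists>x. solution v a x"
  using invariant[of a v] assms by (auto simp: solution_def admissible_def)

lemma solution_bounded:
  assumes V': "\<And>u. u \<in> V \<Longrightarrow> norm u \<le> B'" and v: "v \<in> admissible" "solution v a x" and "0 \<le> t"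
  shows "dist a (x t) \<le> (B + B') * t"
proof -
  have "dist (x 0) (x t) \<le> (B + B') * dist 0 t"
  proof (rule dist_le_speed)
    fix s assume s: "s \<in> {0..t}"
    show "(x has_vector_derivative F (x s) + v s) (at s within {0..t})"
      using v(2) s by (rule solution_deriv)
    show "norm (F (x s) + v s) \<le> B + B'"
      using v s by (intro norm_triangle_le add_mono F_bound V') (auto simp: solution_def admissible_def)
  qed (use \<open>0 \<le> t\<close> in auto)
  then show ?thesis
    using v(2) \<open>0 \<le> t\<close> by (simp add: solution_def)
qed

text \<open>
  By invariance of domain the time-\<open>t\<close> flow map is an open map of \<open>U\<close> into itself, and it shrinks
  distances by at most \<open>exp (- C * t)\<close>. Hence solutions keep a distance from the complement
  of \<open>U\<close> that is uniform in the input.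
\<close>

lemma solution_ball_subset:
  assumes v: "v \<in> admissible" "solution v a x" and r: "cball a r \<subseteq> U" "0 < r" and "0 \<le> t"
  shows "ball (x t) (exp (- C * t) * r) \<subseteq> U"
proof -
  define X where "X = (\<lambda>b. SOME x. solution v b x)"
  define \<Phi> where "\<Phi> b = X b t" for b
  have X: "solution v b (X b)" if "b \<in> U" for b
    unfolding X_def using exists_solution[OF v(1) that] by (rule someI_ex)
  have ball_U: "b \<in> U" if "b \<in> cball a r" for b
    using that r by auto
  have lower: "exp (- C * t) * dist b c \<le> dist (\<Phi> b) (\<Phi> c)"
    and upper: "dist (\<Phi> b) (\<Phi> c) \<le> exp (C * t) * dist b c"
    if "b \<in> cball a r" "c \<in> cball a r" for b c
    using solution_dist[OF X X \<open>0 \<le> t\<close>, of b c] ball_U that by (auto simp: \<Phi>_def)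
  have cont: "continuous_on (cball a r) \<Phi>"
    using upper by (intro lipschitz_on_continuous_on[of "exp (C * t)"] lipschitz_onI) auto
  have inj: "inj_on \<Phi> (cball a r)"
  proof (rule inj_onI)
    fix b c assume "b \<in> cball a r" "c \<in> cball a r" "\<Phi> b = \<Phi> c"
    then have "exp (- C * t) * dist b c \<le> 0"
      using lower[of b c] by simp
    then show "b = c"
      by (simp add: mult_le_0_iff)
  qed
  have a: "a \<in> cball a r" "\<Phi> a = x t"
    using r ball_U[of a] solution_unique[OF X v(2) \<open>0 \<le> t\<close>] by (auto simp: \<Phi>_def)
  let ?B = "ball (x t) (exp (- C * t) * r)"
  \<comment> \<open>Points of the sphere around \<open>a\<close> are sent at least
    \<open>exp (- C * t) * r\<close> away from \<open>x t\<close>, hence outside \<open>?B\<close>.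
    Within \<open>?B\<close> the images of the open and the closed ball agree, so this common part
    is open and closed in a connected set.\<close>
  have "?B \<inter> \<Phi> ` cball a r \<subseteq> \<Phi> ` ball a r"
  proof clarify
    fix b assume b: "\<Phi> b \<in> ?B" "b \<in> cball a r"
    have "exp (- C * t) * dist a b < exp (- C * t) * r"
      by (rule le_less_trans[OF lower[OF a(1) b(2)]]) (use a(2) b(1) in simp)
    then have "dist a b < r"
      by simp
    then show "\<Phi> b \<in> \<Phi> ` ball a r"
      by simp
  qed
  then have eq: "?B \<inter> \<Phi> ` ball a r = ?B \<inter> \<Phi> ` cball a r"
    using ball_subset_cball by blast
  have "openin (top_of_set ?B) (?B \<inter> \<Phi> ` ball a r)"
    using invariance_of_domain_ball[OF cont r(2) inj] by (simp add: openin_open_Int)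
  moreover have "closedin (top_of_set ?B) (?B \<inter> \<Phi> ` ball a r)"
    unfolding eq
    by (intro closedin_closed_Int compact_imp_closed compact_continuous_image cont compact_cball)
  moreover have "x t \<in> ?B \<inter> \<Phi> ` ball a r"
    using r a by (auto intro: rev_image_eqI[of a])
  ultimately have "?B \<inter> \<Phi> ` ball a r = ?B"
    using connected_ball[of "x t" "exp (- C * t) * r"] unfolding connected_clopen by blast
  moreover have "\<Phi> ` ball a r \<subseteq> U"
    using X ball_U \<open>0 \<le> t\<close> by (auto simp: \<Phi>_def solution_def)
  ultimately show ?thesis
    by blast
qed

text \<open>A compact set common to all admissible inputs turns the local Lipschitz condition on a
  feedback into a single constant, valid for all inputs in the fixed point argument.\<close>

lemma solutions_stay_in_compact:
  assumes "a \<in> U" "0 \<le> T"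
  obtains Z where "compact Z" "Z \<subseteq> U"
    "\<And>v x t. v \<in> admissible \<Longrightarrow> solution v a x \<Longrightarrow> t \<in> {0..T} \<Longrightarrow> x t \<in> Z"
proof -
  obtain r where r: "0 < r" "cball a r \<subseteq> U"
    using open_U assms(1) open_contains_cball by blast
  obtain B' where B': "\<And>u. u \<in> V \<Longrightarrow> norm u \<le> B'"
    using compact_imp_bounded[OF V(1)] by (auto simp: bounded_iff)
  have B'_nonneg: "0 \<le> B'" and B_nonneg: "0 \<le> B"
    using V(2) B' F_bound[OF assms(1)] order_trans[OF norm_ge_zero] by blast+
  define \<rho> where "\<rho> = exp (- C * T) * r"
  \<comment> \<open>The distance to the complement is expressed point by point, which stays
    meaningful when \<open>U\<close> is the whole space.\<close>
  define Z where "Z = cball a ((B + B') * T) \<inter> (\<Inter>y\<in>-U. {z. \<rho> \<le> dist y z})"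
  show thesis
  proof
    show "compact Z"
      unfolding Z_def
      by (intro compact_Int_closed closed_INT ballI closed_Collect_le continuous_intros compact_cball)
    show "Z \<subseteq> U"
    proof
      fix z assume "z \<in> Z"
      then have "z \<notin> U \<Longrightarrow> \<rho> \<le> dist z z"
        unfolding Z_def by blast
      moreover have "0 < \<rho>"
        using r by (simp add: \<rho>_def)
      ultimately show "z \<in> U"
        by fastforce
    qed
    fix v x t assume v: "v \<in> admissible" "solution v a x" and t: "t \<in> {0..T}"
    have "dist a (x t) \<le> (B + B') * t"
      using solution_bounded[OF B' v] t by auto
    also have "\<dots> \<le> (B + B') * T"
      using t B'_nonneg B_nonneg by (intro mult_left_mono) auto
    finally have "x t \<in> cball a ((B + B') * T)"
      by simp
    moreover have "\<rho> \<le> dist y (x t)" if "y \<notin> U" for y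
    proof -
      have "y \<notin> ball (x t) (exp (- C * t) * r)"
        using solution_ball_subset[OF v r(2,1), of t] t that by auto
      then have "exp (- C * t) * r \<le> dist y (x t)"
        by (simp add: dist_commute)
      moreover have "\<rho> \<le> exp (- C * t) * r"
        unfolding \<rho>_def using t r C_nonneg by (intro mult_right_mono) (auto simp: mult_left_mono)
      ultimately show ?thesis
        by simp
    qed
    ultimately show "x t \<in> Z"
      by (simp add: Z_def)
  qed
qed

text \<open>
  The closed-loop input \<open>v\<close> is a fixed point of \<open>v \<mapsto> (t \<mapsto> g t (x\<^sub>v t))\<close>, where
  \<open>x\<^sub>v\<close> is the open-loop solution. Iterating on inputs rather than on trajectories keeps every
  iterate inside \<open>U\<close>; in the norm weighted by \<open>exp (- \<alpha> * t)\<close> the map is a contraction on all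
  of \<open>{0..T}\<close>.
\<close>

theorem exists_closed_loop_solution:
  assumes a: "a \<in> U" and "0 \<le> T"
    and g_lipschitz: "local_lipschitz {0..T} U g"
    and g_cont: "continuous_on ({0..T} \<times> U) (\<lambda>(t, x). g t x)"
    and g_V: "\<And>v x t. v \<in> admissible \<Longrightarrow> solution v a x \<Longrightarrow> t \<in> {0..T} \<Longrightarrow> g t (x t) \<in> V"
  shows "\<exists>x. x 0 = a \<and>
    (\<forall>t\<in>{0..T}. x t \<in> U \<and> (x has_vector_derivative F (x t) + g t (x t)) (at t within {0..T}))"
proof -
  obtain Z where Z: "compact Z" "Z \<subseteq> U"
    "\<And>v x t. v \<in> admissible \<Longrightarrow> solution v a x \<Longrightarrow> t \<in> {0..T} \<Longrightarrow> x t \<in> Z"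
    using solutions_stay_in_compact[OF a \<open>0 \<le> T\<close>] by blast
  have "continuous_on {0..T} (\<lambda>t. g t x)" if "x \<in> Z" for x
    using continuous_on_compose2[OF g_cont, of "{0..T}" "\<lambda>t. (t, x)"] that Z(2)
    by (force intro!: continuous_intros)
  then obtain K where K: "\<And>t. t \<in> {0..T} \<Longrightarrow> K-lipschitz_on Z (g t)"
    using local_lipschitz_compact_implies_lipschitz[OF
        local_lipschitz_subset[OF g_lipschitz subset_refl Z(2)] Z(1) compact_Icc] by blast
  have K_nonneg: "0 \<le> K"
    using lipschitz_on_nonneg[OF K[of 0]] \<open>0 \<le> T\<close> by simp
  \<comment> \<open>This choice gives \<open>K / sqrt b \<le> 1 / 2\<close>, the contraction
    factor.\<close>
  define b where "b = 4 * K\<^sup>2 + 1"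
  define \<alpha> where "\<alpha> = C + 1 / 2 + b / 2"
  \<comment> \<open>Times are clamped to \<open>{0..T}\<close> because inputs and bounded continuous
    functions live on the whole real line.\<close>
  define c where "c t = max 0 (min t T)" for t
  define X where "X = (\<lambda>v. SOME x. solution v a x)"
  \<comment> \<open>\<open>u\<close> stores the input already multiplied by
    \<open>exp (- \<alpha> * c t)\<close>, and \<open>E u\<close> is the input itself; so the
    ordinary supremum distance of such \<open>u\<close> is the weighted distance of the
    inputs.\<close>
  define E where "E = (\<lambda>(u :: real \<Rightarrow>\<^sub>C 'a) t. exp (\<alpha> * c t) *\<^sub>R apply_bcontfun u t)"
  define S where "S = {u. range (E u) \<subseteq> V}"
  define G where "G = (\<lambda>u t. exp (- (\<alpha> * c t)) *\<^sub>R g (c t) (X (E u) (c t)))"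
  have b: "0 < b" "2 * K \<le> sqrt b"
    using K_nonneg by (auto simp: b_def intro!: real_le_rsqrt add_nonneg_pos)
  have \<alpha>: "0 < \<alpha>"
    using b C_nonneg by (simp add: \<alpha>_def)
  have c_cont: "continuous_on A c" for A
    unfolding c_def by (intro continuous_intros)
  have c: "c t \<in> {0..T}" "t \<in> {0..T} \<Longrightarrow> c t = t" "t \<ge> 0 \<Longrightarrow> c t \<le> t" for t
    using \<open>0 \<le> T\<close> by (auto simp: c_def)
  have adm: "E u \<in> admissible" if "u \<in> S" for u
    using that by (auto simp: E_def S_def admissible_def intro!: continuous_intros c_cont)
  have X: "solution v a (X v)" if "v \<in> admissible" for v
    unfolding X_def using exists_solution[OF that a] by (rule someI_ex)
  have G_V: "g (c t) (X (E u) (c t)) \<in> V" if "u \<in> S" for u t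
    using g_V[OF adm[OF that] X[OF adm[OF that]] c(1)] .
  obtain B' where B': "\<And>u. u \<in> V \<Longrightarrow> norm u \<le> B'"
    using compact_imp_bounded[OF V(1)] by (auto simp: bounded_iff)
  have G: "G u \<in> bcontfun" if u: "u \<in> S" for u
  proof (rule bcontfun_normI)
    have "continuous_on UNIV (\<lambda>t. X (E u) (c t))"
    proof (rule continuous_on_compose2[OF _ c_cont])
      show "continuous_on {0..T} (X (E u))"
        using solution_deriv[OF X[OF adm[OF u]]]
        by (intro continuous_on_vector_derivative) auto
    qed (use c in auto)
    then have "continuous_on UNIV (\<lambda>t. (c t, X (E u) (c t)))"
      by (intro continuous_intros c_cont)
    then have "continuous_on UNIV (\<lambda>t. (\<lambda>(t, x). g t x) (c t, X (E u) (c t)))"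
      using c(1) Z(2) Z(3)[OF adm[OF u] X[OF adm[OF u]] c(1)]
      by (intro continuous_on_compose2[OF g_cont]) auto
    then show "continuous_on UNIV (G u)"
      unfolding G_def by (auto intro!: continuous_intros c_cont)
    fix t
    have "norm (G u t) = exp (- (\<alpha> * c t)) * norm (g (c t) (X (E u) (c t)))"
      by (simp add: G_def)
    also have "\<dots> \<le> 1 * B'"
      using \<alpha> c(1)[of t] G_V[OF u] by (intro mult_mono B') auto
    finally show "norm (G u t) \<le> B'"
      by simp
  qed
  have app: "apply_bcontfun (Bcontfun (G u)) = G u" if "u \<in> S" for u
    using G[OF that] by (rule Bcontfun_inverse)
  have E_G: "E (Bcontfun (G u)) t = g (c t) (X (E u) (c t))" if "u \<in> S" for u t
    unfolding E_def app[OF that] by (simp add: G_def exp_minus E_def)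
  have "\<exists>!u\<in>S. Bcontfun (G u) = u"
  proof (rule Banach_fix[where c = "1 / 2"])
    show "complete S"
    proof -
      have "closed {u. exp (\<alpha> * c t) *\<^sub>R apply_bcontfun u t \<in> V}" for t
      proof -
        have "continuous_on UNIV (\<lambda>u::real \<Rightarrow>\<^sub>C 'a. apply_bcontfun u t)"
          by (intro lipschitz_on_continuous_on[of 1] lipschitz_onI) (auto simp: dist_bounded)
        then have "continuous_on UNIV (\<lambda>u::real \<Rightarrow>\<^sub>C 'a. exp (\<alpha> * c t) *\<^sub>R apply_bcontfun u t)"
          by (intro continuous_intros)
        then show ?thesis
          using continuous_closed_vimage[OF compact_imp_closed[OF V(1)]]
          by (auto simp: vimage_def continuous_on_eq_continuous_at)
      qed
      moreover have "S = (\<Inter>t. {u. exp (\<alpha> * c t) *\<^sub>R apply_bcontfun u t \<in> V})"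
        by (auto simp: S_def E_def)
      ultimately show ?thesis
        by (simp add: complete_eq_closed closed_INT)
    qed
    obtain v0 where v0: "v0 \<in> V"
      using V(2) by blast
    have "(\<lambda>t. exp (- (\<alpha> * c t)) *\<^sub>R v0) \<in> bcontfun"
      using \<alpha> c(1) by (intro bcontfun_normI[where b = "norm v0"] continuous_intros c_cont)
        (auto intro!: mult_left_le_one_le)
    then have "E (Bcontfun (\<lambda>t. exp (- (\<alpha> * c t)) *\<^sub>R v0)) = (\<lambda>t. v0)"
      by (simp add: E_def Bcontfun_inverse exp_minus)
    then have "Bcontfun (\<lambda>t. exp (- (\<alpha> * c t)) *\<^sub>R v0) \<in> S"
      using v0 by (simp add: S_def)
    then show "S \<noteq> {}"
      by blast
    show "(\<lambda>u. Bcontfun (G u)) ` S \<subseteq> S"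
      using E_G G_V by (auto simp: S_def)
    fix u u' assume u: "u \<in> S" "u' \<in> S"
    show "dist (Bcontfun (G u)) (Bcontfun (G u')) \<le> 1 / 2 * dist u u'"
    proof (rule dist_bound)
      fix t
      let ?x = "X (E u) (c t)" and ?y = "X (E u') (c t)"
      have "norm (?x - ?y) \<le> dist u u' / sqrt b * exp ((C + 1 / 2 + b / 2) * c t)"
      proof (rule solution_input_dist[OF X[OF adm[OF u(1)]] X[OF adm[OF u(2)]] b(1) _ c(1)])
        fix s assume s: "s \<in> {0..T}"
        have "norm (E u s - E u' s) = exp (\<alpha> * s) * dist (apply_bcontfun u s) (apply_bcontfun u' s)"
          using c(2)[OF s] by (simp add: E_def dist_norm flip: scaleR_diff_right)
        also have "\<dots> \<le> exp (\<alpha> * s) * dist u u'"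
          by (intro mult_left_mono dist_bounded) auto
        finally show "norm (E u s - E u' s) \<le> dist u u' * exp ((C + 1 / 2 + b / 2) * s)"
          by (simp add: \<alpha>_def mult.commute)
      qed auto
      then have xy: "norm (?x - ?y) \<le> dist u u' / sqrt b * exp (\<alpha> * c t)"
        by (simp add: \<alpha>_def)
      have "dist (G u t) (G u' t) = exp (- (\<alpha> * c t)) * dist (g (c t) ?x) (g (c t) ?y)"
        by (simp add: G_def dist_norm flip: scaleR_diff_right)
      also have "\<dots> \<le> exp (- (\<alpha> * c t)) * (K * dist ?x ?y)"
        using u by (intro mult_left_mono lipschitz_onD[OF K] Z(3)[OF adm X[OF adm]] c(1)) auto
      also have "\<dots> \<le> exp (- (\<alpha> * c t)) * (K * (dist u u' / sqrt b * exp (\<alpha> * c t)))"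
        using xy K_nonneg by (intro mult_left_mono) (auto simp: dist_norm)
      also have "\<dots> = K / sqrt b * dist u u'"
        by (simp add: exp_minus)
      also have "\<dots> \<le> 1 / 2 * dist u u'"
        using b by (intro mult_right_mono) (auto simp: field_simps)
      finally show "dist (apply_bcontfun (Bcontfun (G u)) t) (apply_bcontfun (Bcontfun (G u')) t)
          \<le> 1 / 2 * dist u u'"
        by (simp add: app u)
    qed
  qed auto
  then obtain u where u: "u \<in> S" "Bcontfun (G u) = u"
    by blast
  have E_u: "E u t = g t (X (E u) t)" if "t \<in> {0..T}" for t
    using E_G[OF u(1), of t] u(2) c(2)[OF that] by simp
  show ?thesis
  proof (intro exI[of _ "X (E u)"] conjI ballI)
    show "X (E u) 0 = a"
      using X[OF adm[OF u(1)]] by (simp add: solution_def)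
    fix t assume t: "t \<in> {0..T}"
    show "X (E u) t \<in> U"
      using Z(2,3) adm[OF u(1)] X t by blast
    show "(X (E u) has_vector_derivative F (X (E u) t) + g t (X (E u) t)) (at t within {0..T})"
      using solution_deriv[OF X[OF adm[OF u(1)]] t] E_u[OF t] by simp
  qed
qed

end

section \<open>Coupled agents\<close>

lemma tuple_dist_Cons:
  "tuple_dist (x # xs) (y # ys) = sqrt ((dist x y)\<^sup>2 + (tuple_dist xs ys)\<^sup>2)"
  by (simp add: tuple_dist_def L2_set_def sum.lessThan_Suc_shift sum_nonneg del: sum.lessThan_Suc)

lemma tuple_dist_refl [simp]: "tuple_dist xs xs = 0"
  by (simp add: tuple_dist_def L2_set_def)

lemma tuple_dist_nonneg [simp]: "0 \<le> tuple_dist xs ys"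
  by (simp add: tuple_dist_def L2_set_nonneg)

lemma tuple_dist_Cons_ge:
  "dist x y \<le> tuple_dist (x # xs) (y # ys)" "tuple_dist xs ys \<le> tuple_dist (x # xs) (y # ys)"
  by (auto simp: tuple_dist_Cons intro!: real_le_rsqrt)

lemma tuple_dist_le:
  assumes "\<And>m. m < length xs \<Longrightarrow> dist (xs ! m) (ys ! m) \<le> r" "0 \<le> r"
  shows "tuple_dist xs ys \<le> sqrt (length xs) * r"
proof -
  have "tuple_dist xs ys \<le> L2_set (\<lambda>_. r) {..<length xs}"
    unfolding tuple_dist_def using assms by (intro L2_set_mono) auto
  then show ?thesis
    using assms(2) by (simp add: L2_set_def real_sqrt_mult)
qed

lemma norm_vec_le:
  fixes v :: "('a::real_normed_vector) ^ 'i"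
  assumes "\<And>m. norm (v $ m) \<le> b m"
  shows "norm v \<le> (\<Sum>m\<in>UNIV. b m)"
  unfolding norm_vec_def using assms
  by (intro order_trans[OF L2_set_le_sum] sum_mono) auto

text \<open>Truncation shifts a vector by no more than the excess of its norm over \<open>r\<close>,
  as comparison with the rescaled vector \<open>(r / norm q) *\<^sub>R q\<close> shows.\<close>

lemma norm_closest_point_cball_diff_le:
  fixes q :: "'a::euclidean_space"
  assumes "0 \<le> r" "0 \<le> e" "norm q \<le> r + e"
  shows "norm (closest_point (cball 0 r) q - q) \<le> e"
proof (cases "norm q \<le> r")
  case True
  then show ?thesis
    using assms by (simp add: closest_point_self)
next
  case False
  then have q: "0 < norm q" "r / norm q \<le> 1"
    using assms by (auto simp: divide_le_eq_1)
  have "dist q (closest_point (cball 0 r) q) \<le> dist q ((r / norm q) *\<^sub>R q)"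
    using q assms by (intro closest_point_le) auto
  also have "\<dots> = norm ((1 - r / norm q) *\<^sub>R q)"
    by (simp add: dist_norm algebra_simps)
  also have "\<dots> = norm q - r"
    using q by (simp add: left_diff_distrib)
  finally show ?thesis
    using assms by (simp add: dist_norm norm_minus_commute)
qed

lemma local_lipschitz_vec:
  fixes g :: "'t::metric_space \<Rightarrow> 'x::metric_space \<Rightarrow> ('a::euclidean_space) ^ 'i::finite"
  assumes "\<And>m. local_lipschitz T X (\<lambda>t x. g t x $ m)"
  shows "local_lipschitz T X g"
proof (rule local_lipschitzI)
  fix t x assume "t \<in> T" "x \<in> X"
  then have "\<forall>m. \<exists>u>0. \<exists>L. \<forall>s\<in>cball t u \<inter> T. L-lipschitz_on (cball x u \<inter> X) (\<lambda>x. g s x $ m)"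
    using assms unfolding local_lipschitz_def by blast
  then obtain u L where u: "\<And>m. 0 < u m"
    and L: "\<And>m s. s \<in> cball t (u m) \<inter> T \<Longrightarrow> (L m)-lipschitz_on (cball x (u m) \<inter> X) (\<lambda>x. g s x $ m)"
    by metis
  define r where "r = Min (range u)"
  have r: "r \<le> u m" for m
    by (simp add: r_def)
  have "(\<Sum>m\<in>UNIV. L m)-lipschitz_on (cball x r \<inter> X) (g s)" if s: "s \<in> cball t r \<inter> T" for s
  proof (rule lipschitz_onI)
    have s': "s \<in> cball t (u m) \<inter> T" for m
      using s r[of m] by auto
    show "0 \<le> (\<Sum>m\<in>UNIV. L m)"
      using lipschitz_on_nonneg[OF L[OF s']] by (intro sum_nonneg)
    fix y z assume "y \<in> cball x r \<inter> X" "z \<in> cball x r \<inter> X"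
    then have "y \<in> cball x (u m) \<inter> X" "z \<in> cball x (u m) \<inter> X" for m
      using r[of m] by auto
    then have "norm ((g s y - g s z) $ m) \<le> L m * dist y z" for m
      using lipschitz_onD[OF L[OF s', of m], of y z] by (simp add: dist_norm)
    then have "norm (g s y - g s z) \<le> (\<Sum>m\<in>UNIV. L m * dist y z)"
      by (rule norm_vec_le)
    then show "dist (g s y) (g s z) \<le> (\<Sum>m\<in>UNIV. L m) * dist y z"
      by (simp add: dist_norm sum_distrib_right)
  qed
  moreover have "0 < r"
    using u by (simp add: r_def)
  ultimately show "\<exists>u>0. \<exists>L. \<forall>s\<in>cball t u \<inter> T. L-lipschitz_on (cball x u \<inter> X) (g s)"
    by blast
qed

lemma piecewise_continuous_if_continuous:
  assumes "continuous_on UNIV v"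
  shows "piecewise_continuous v"
proof -
  have v: "(v \<longlongrightarrow> v t) (at t within A)" for t A
    using assms by (auto simp: continuous_on_def intro: tendsto_within_subset)
  then show ?thesis
    unfolding piecewise_continuous_def continuous_within by auto
qed

section \<open>The agents as one controlled system\<close>

locale multi_agent_system =
  fixes D :: "(real ^ 'n) set"
    and nbr :: "'i::finite \<Rightarrow> 'i list"
    and f :: "'i \<Rightarrow> real ^ 'n \<Rightarrow> (real ^ 'n) list \<Rightarrow> real ^ 'n"
    and M vmax L1 L2 :: real
  assumes nbr: "\<And>i. distinct (nbr i)" "\<And>i. i \<notin> set (nbr i)"
    and open_D: "open D"
    and f_bound: "\<And>i x xs. x \<in> D \<Longrightarrow> xs \<in> tuples (length (nbr i)) D \<Longrightarrow> norm (f i x xs) \<le> M"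
    and vmax: "0 < vmax" "vmax < M" and L1_pos: "0 < L1" and L2_pos: "0 < L2"
    and f_lipschitz_nbr: "\<And>i x xs ys. x \<in> D \<Longrightarrow> xs \<in> tuples (length (nbr i)) D \<Longrightarrow>
      ys \<in> tuples (length (nbr i)) D \<Longrightarrow>
      norm (f i x xs - f i x ys) \<le> L1 * tuple_dist (x # xs) (x # ys)"
    and f_lipschitz_self: "\<And>i x y xs. x \<in> D \<Longrightarrow> y \<in> D \<Longrightarrow> xs \<in> tuples (length (nbr i)) D \<Longrightarrow>
      norm (f i x xs - f i y xs) \<le> L2 * tuple_dist (x # xs) (y # xs)"
    and invariance: "invariance_assumption D nbr f vmax"
begin

definition U :: "((real ^ 'n) ^ 'i) set" where
  "U = {x. \<forall>i. x $ i \<in> D}"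

definition F :: "(real ^ 'n) ^ 'i \<Rightarrow> (real ^ 'n) ^ 'i" where
  "F x = (\<chi> i. f i (x $ i) (nbr_states nbr i x))"

definition V :: "((real ^ 'n) ^ 'i) set" where
  "V = {v. \<forall>i. norm (v $ i) \<le> vmax}"

lemma nbr_states_tuples: "x \<in> U \<Longrightarrow> nbr_states nbr i x \<in> tuples (length (nbr i)) D"
  by (auto simp: U_def tuples_def)

lemma f_lipschitz_nbr':
  assumes "x \<in> D" "xs \<in> tuples (length (nbr i)) D" "ys \<in> tuples (length (nbr i)) D"
  shows "norm (f i x xs - f i x ys) \<le> L1 * tuple_dist xs ys"
  using f_lipschitz_nbr[OF assms] by (simp add: tuple_dist_Cons)

lemma f_lipschitz_self':
  assumes "x \<in> D" "y \<in> D" "xs \<in> tuples (length (nbr i)) D"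
  shows "norm (f i x xs - f i y xs) \<le> L2 * dist x y"
  using f_lipschitz_self[OF assms] by (simp add: tuple_dist_Cons)

lemma f_lipschitz:
  assumes "x \<in> D" "y \<in> D" "xs \<in> tuples (length (nbr i)) D" "ys \<in> tuples (length (nbr i)) D"
  shows "norm (f i x xs - f i y ys) \<le> (L1 + L2) * tuple_dist (x # xs) (y # ys)"
proof -
  have "norm (f i x xs - f i y ys) \<le> norm (f i x xs - f i y xs) + norm (f i y xs - f i y ys)"
    using norm_triangle_ineq[of "f i x xs - f i y xs" "f i y xs - f i y ys"] by simp
  also have "\<dots> \<le> L2 * dist x y + L1 * tuple_dist xs ys"
    using assms by (intro add_mono f_lipschitz_self' f_lipschitz_nbr')
  also have "\<dots> \<le> L2 * tuple_dist (x # xs) (y # ys) + L1 * tuple_dist (x # xs) (y # ys)"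
    using L1_pos L2_pos by (intro add_mono mult_left_mono tuple_dist_Cons_ge) auto
  finally show ?thesis
    by (simp add: algebra_simps)
qed

lemma tuple_dist_states_le:
  "tuple_dist (x $ i # nbr_states nbr i x) (y $ i # nbr_states nbr i y)
     \<le> sqrt (Suc (length (nbr i))) * dist x y"
proof -
  have "dist ((x $ i # nbr_states nbr i x) ! m) ((y $ i # nbr_states nbr i y) ! m) \<le> dist x y"
    if "m < Suc (length (nbr i))" for m
    using that by (cases m) (auto intro: dist_vec_nth_le)
  then have "tuple_dist (x $ i # nbr_states nbr i x) (y $ i # nbr_states nbr i y)
     \<le> sqrt (length (x $ i # nbr_states nbr i x)) * dist x y"
    by (intro tuple_dist_le) auto
  then show ?thesis
    by simp
qed

lemma f_states_lipschitz:
  assumes "x \<in> U" "y \<in> U"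
  shows "norm (f i (x $ i) (nbr_states nbr i x) - f i (y $ i) (nbr_states nbr i y))
    \<le> (L1 + L2) * sqrt (Suc (length (nbr i))) * dist x y"
proof -
  have "norm (f i (x $ i) (nbr_states nbr i x) - f i (y $ i) (nbr_states nbr i y))
    \<le> (L1 + L2) * tuple_dist (x $ i # nbr_states nbr i x) (y $ i # nbr_states nbr i y)"
    using assms by (intro f_lipschitz nbr_states_tuples) (auto simp: U_def)
  also have "\<dots> \<le> (L1 + L2) * (sqrt (Suc (length (nbr i))) * dist x y)"
    using L1_pos L2_pos by (intro mult_left_mono tuple_dist_states_le) auto
  finally show ?thesis
    by (simp add: mult.assoc)
qed

text \<open>The Lipschitz constant and the bound of the joint field are crude sums over the agents
  and serve existence only. The quantitative estimates are made agent by agent with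
  \<open>M\<close>, \<open>L1\<close> and \<open>L2\<close>.\<close>

sublocale controlled_system U F V "\<Sum>i\<in>UNIV. (L1 + L2) * sqrt (Suc (length (nbr i)))" "\<Sum>i\<in>(UNIV::'i set). M"
proof
  have "U = (\<Inter>i. (\<lambda>x. x $ i) -` D)"
    by (auto simp: U_def)
  then show "open U"
    using open_D by (auto intro!: open_INT open_vimage_vec_nth)
  show "(\<Sum>i\<in>UNIV. (L1 + L2) * sqrt (Suc (length (nbr i))))-lipschitz_on U F"
  proof (rule lipschitz_onI)
    fix x y assume "x \<in> U" "y \<in> U"
    then have "norm (F x - F y) \<le> (\<Sum>i\<in>UNIV. (L1 + L2) * sqrt (Suc (length (nbr i))) * dist x y)"
      using f_states_lipschitz by (intro norm_vec_le) (simp add: F_def)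
    then show "dist (F x) (F y) \<le> (\<Sum>i\<in>UNIV. (L1 + L2) * sqrt (Suc (length (nbr i)))) * dist x y"
      unfolding dist_norm[of "F x"] sum_distrib_right .
  qed (use L1_pos L2_pos in \<open>auto intro!: sum_nonneg\<close>)
  show "norm (F x) \<le> (\<Sum>i\<in>(UNIV::'i set). M)" if "x \<in> U" for x
    using that by (intro norm_vec_le) (auto simp: F_def U_def intro!: f_bound nbr_states_tuples[OF that])
  have "bounded V"
    unfolding bounded_iff V_def by (auto intro!: exI[of _ "\<Sum>i\<in>(UNIV::'i set). vmax"] norm_vec_le)
  moreover have "closed V"
    unfolding V_def by (intro closed_Collect_all closed_Collect_le continuous_intros)
  ultimately show "compact V"
    by (simp add: compact_eq_bounded_closed)
  show "V \<noteq> {}"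
    using vmax by (auto simp: V_def intro!: exI[of _ 0])
  fix a and v :: "real \<Rightarrow> (real ^ 'n) ^ 'i" assume a: "a \<in> U" and v: "continuous_on UNIV v" "range v \<subseteq> V"
  then have "piecewise_continuous v" "\<forall>t\<ge>0. \<forall>i. norm (v t $ i) \<le> vmax" "\<forall>i. a $ i \<in> D"
    by (auto simp: piecewise_continuous_if_continuous V_def U_def)
  then obtain x where "system_solution D nbr f v a x"
    using invariance unfolding invariance_assumption_def by blast
  moreover have "continuous (at t within {0..}) v" for t
    using v(1) by (auto simp: continuous_on_eq_continuous_within intro: continuous_within_subset)
  moreover have "(\<chi> i. f i (x t $ i) (nbr_states nbr i (x t)) + v t $ i) = F (x t) + v t" for t
    by (simp add: vec_eq_iff F_def)
  ultimately show "\<exists>x. x 0 = a \<and> (\<forall>t\<ge>0. x t \<in> U \<and> (x has_vector_derivative F (x t) + v t) (at t within {0..}))"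
    unfolding system_solution_def U_def by auto
qed

text \<open>This explains the enlargement by \<open>dt * (M + vmax)\<close> in
  \<open>property_P\<close>: under any admissible input, each agent remains up to time
  \<open>dt\<close> where the feedbacks are known to be bounded.\<close>

lemma agent_speed:
  assumes v: "v \<in> admissible" "solution v a x" and t: "t \<in> {0..T}"
  shows "dist (a $ m) (x t $ m) \<le> (M + vmax) * t"
proof -
  have "dist (x 0 $ m) (x t $ m) \<le> (M + vmax) * dist 0 t"
  proof (rule dist_le_speed)
    fix s assume s: "s \<in> {0..T}"
    then have "x s \<in> U"
      using v by (simp add: solution_def)
    then have "norm (f m (x s $ m) (nbr_states nbr m (x s))) \<le> M"
      by (intro f_bound nbr_states_tuples) (auto simp: U_def)
    moreover have "v s \<in> V"
      using v(1) by (auto simp: admissible_def)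
    then have "norm (v s $ m) \<le> vmax"
      by (simp add: V_def)
    ultimately show "norm ((F (x s) + v s) $ m) \<le> M + vmax"
      by (auto simp: F_def intro!: norm_triangle_le)
    show "((\<lambda>t. x t $ m) has_vector_derivative (F (x s) + v s) $ m) (at s within {0..T})"
      using solution_deriv[OF v(2) s] by (rule bounded_linear.has_vector_derivative[OF bounded_linear_vec_nth])
  qed (use t in auto)
  then show ?thesis
    using v t by (simp add: solution_def)
qed

text \<open>Passes from the tuple distance in \<open>locally_Lipschitz_feedback\<close> to the
  distance of joint states. The price is the factor \<open>sqrt (Suc (length (nbr m)))\<close>,
  since each component of the tuple differs by at most the joint distance.\<close>

lemma locally_Lipschitz_feedbackE:
  assumes k: "locally_Lipschitz_feedback D (length (nbr m)) T k" and dt: "ereal dt < T"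
    and t: "t \<in> {0..dt}" and x: "x \<in> U"
  obtains r C where "0 < r" "0 \<le> C"
    "\<And>s s' y y'. s \<in> {0..dt} \<Longrightarrow> s' \<in> {0..dt} \<Longrightarrow> y \<in> U \<Longrightarrow> y' \<in> U \<Longrightarrow>
       dist t s < r \<Longrightarrow> dist t s' < r \<Longrightarrow> dist x y < r \<Longrightarrow> dist x y' < r \<Longrightarrow>
       norm (k s (y $ m) (nbr_states nbr m y) - k s' (y' $ m) (nbr_states nbr m y'))
         \<le> C * (dist s s' + dist y y')"
proof -
  define c where "c = sqrt (Suc (length (nbr m)))"
  define d where "d = (\<lambda>t (x :: (real ^ 'n) ^ 'i) s y.
    sqrt ((t - s)\<^sup>2 + (tuple_dist (x $ m # nbr_states nbr m x) (y $ m # nbr_states nbr m y))\<^sup>2))"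
  have c: "1 \<le> c"
    by (simp add: c_def)
  have d_le: "d t x s y \<le> c * (dist t s + dist x y)" for t x s y
  proof -
    have "d t x s y \<le> dist t s + tuple_dist (x $ m # nbr_states nbr m x) (y $ m # nbr_states nbr m y)"
      unfolding d_def dist_real_def
      by (rule order_trans[OF sqrt_sum_squares_le_sum_abs]) simp
    also have "\<dots> \<le> c * dist t s + c * dist x y"
      unfolding c_def using c mult_right_mono[of 1 c "dist t s"]
      by (intro add_mono tuple_dist_states_le) (auto simp: c_def)
    finally show ?thesis
      by (simp add: algebra_simps)
  qed
  have dom: "0 \<le> s \<and> ereal s < T \<and> y $ m \<in> D \<and> nbr_states nbr m y \<in> tuples (length (nbr m)) D"
    if "s \<in> {0..dt}" "y \<in> U" for s y
    using that nbr_states_tuples[OF that(2)] le_less_trans[OF _ dt, of "ereal s"] by (auto simp: U_def)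
  obtain r0 C0 where r0: "0 < r0" and C0:
    "\<And>s s' y y'. s \<in> {0..dt} \<Longrightarrow> s' \<in> {0..dt} \<Longrightarrow> y \<in> U \<Longrightarrow> y' \<in> U \<Longrightarrow>
       d t x s y < r0 \<Longrightarrow> d t x s' y' < r0 \<Longrightarrow>
       norm (k s (y $ m) (nbr_states nbr m y) - k s' (y' $ m) (nbr_states nbr m y')) \<le> C0 * d s y s' y'"
  proof -
    define Q where "Q = {(t, x, xs). 0 \<le> t \<and> ereal t < T \<and> x \<in> D \<and> xs \<in> tuples (length (nbr m)) D}"
    define d' where "d' = (\<lambda>(t, x, xs) (s, y, ys). sqrt ((t - s)\<^sup>2 + (tuple_dist (x # xs) (y # ys :: (real ^ 'n) list))\<^sup>2))"
    define k' where "k' = (\<lambda>(t, x, xs). k t x xs)"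
    have "\<forall>p\<in>Q. \<exists>r>0. \<exists>C. \<forall>q\<in>Q. \<forall>q'\<in>Q. d' p q < r \<longrightarrow> d' p q' < r \<longrightarrow> norm (k' q - k' q') \<le> C * d' q q'"
      using k unfolding locally_Lipschitz_feedback_def Let_def Q_def d'_def k'_def .
    moreover have "(t, x $ m, nbr_states nbr m x) \<in> Q"
      using dom[OF t x] by (simp add: Q_def)
    ultimately obtain r C where "0 < r" and *: "\<forall>q\<in>Q. \<forall>q'\<in>Q. d' (t, x $ m, nbr_states nbr m x) q < r \<longrightarrow>
        d' (t, x $ m, nbr_states nbr m x) q' < r \<longrightarrow> norm (k' q - k' q') \<le> C * d' q q'"
      by blast
    show thesis
    proof (rule that[OF \<open>0 < r\<close>])
      fix s s' y y' assume "s \<in> {0..dt}" "s' \<in> {0..dt}" "y \<in> U" "y' \<in> U" "d t x s y < r" "d t x s' y' < r"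
      then show "norm (k s (y $ m) (nbr_states nbr m y) - k s' (y' $ m) (nbr_states nbr m y')) \<le> C * d s y s' y'"
        using bspec[OF bspec[OF *], of "(s, y $ m, nbr_states nbr m y)" "(s', y' $ m, nbr_states nbr m y')"]
          dom[of s y] dom[of s' y']
        by (simp add: d_def d'_def k'_def Q_def)
    qed
  qed
  show thesis
  \<comment> \<open>Half of \<open>r0 / c\<close> each for the time and the state distance keeps
    their sum below \<open>r0 / c\<close>; the absolute value guards against a negative
    \<open>C0\<close>.\<close>
  proof (rule that[of "r0 / (2 * c)" "\<bar>C0\<bar> * c"])
    show "0 < r0 / (2 * c)" "0 \<le> \<bar>C0\<bar> * c"
      using r0 c by auto
    fix s s' y y' assume s: "s \<in> {0..dt}" "s' \<in> {0..dt}" "y \<in> U" "y' \<in> U"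
      and near: "dist t s < r0 / (2 * c)" "dist t s' < r0 / (2 * c)" "dist x y < r0 / (2 * c)" "dist x y' < r0 / (2 * c)"
    have "c * (a + b) < r0" if "a < r0 / (2 * c)" "b < r0 / (2 * c)" for a b
      using add_strict_mono[OF that] c by (simp add: field_simps)
    then have "d t x s y < r0" "d t x s' y' < r0"
      using near d_le by (meson le_less_trans)+
    then have "norm (k s (y $ m) (nbr_states nbr m y) - k s' (y' $ m) (nbr_states nbr m y')) \<le> C0 * d s y s' y'"
      using s by (intro C0)
    also have "\<dots> \<le> \<bar>C0\<bar> * (c * (dist s s' + dist y y'))"
      by (rule mult_mono) (use d_le in \<open>auto simp: d_def\<close>)
    finally show "norm (k s (y $ m) (nbr_states nbr m y) - k s' (y' $ m) (nbr_states nbr m y'))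
        \<le> \<bar>C0\<bar> * c * (dist s s' + dist y y')"
      by (simp add: mult.assoc)
  qed
qed

lemma feedback_regular:
  assumes k: "locally_Lipschitz_feedback D (length (nbr m)) T k" and dt: "ereal dt < T"
  shows "local_lipschitz {0..dt} U (\<lambda>t x. k t (x $ m) (nbr_states nbr m x))"
    and "continuous_on ({0..dt} \<times> U) (\<lambda>(t, x). k t (x $ m) (nbr_states nbr m x))"
proof -
  let ?k = "\<lambda>t x. k t (x $ m) (nbr_states nbr m x)"
  show "local_lipschitz {0..dt} U ?k"
  proof (rule local_lipschitzI)
    fix t x assume "t \<in> {0..dt}" "x \<in> U"
    then obtain r C where r: "0 < r" "0 \<le> C" and
      C: "\<And>s s' y y'. s \<in> {0..dt} \<Longrightarrow> s' \<in> {0..dt} \<Longrightarrow> y \<in> U \<Longrightarrow> y' \<in> U \<Longrightarrow>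
       dist t s < r \<Longrightarrow> dist t s' < r \<Longrightarrow> dist x y < r \<Longrightarrow> dist x y' < r \<Longrightarrow>
       norm (?k s y - ?k s' y') \<le> C * (dist s s' + dist y y')"
      using locally_Lipschitz_feedbackE[OF k dt] by metis
    have "C-lipschitz_on (cball x (r / 2) \<inter> U) (?k s)" if "s \<in> cball t (r / 2) \<inter> {0..dt}" for s
    proof (rule lipschitz_onI)
      fix y y' assume "y \<in> cball x (r / 2) \<inter> U" "y' \<in> cball x (r / 2) \<inter> U"
      then show "dist (?k s y) (?k s y') \<le> C * dist y y'"
        using C[of s s y y'] that r by (auto simp: dist_norm)
    qed fact
    then show "\<exists>u>0. \<exists>L. \<forall>s\<in>cball t u \<inter> {0..dt}. L-lipschitz_on (cball x u \<inter> U) (?k s)"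
      using r by (intro exI[of _ "r / 2"] exI[of _ C] conjI ballI) auto
  qed
  show "continuous_on ({0..dt} \<times> U) (\<lambda>(t, x). ?k t x)"
    unfolding continuous_on_iff
  proof (intro ballI allI impI)
    fix p e assume p: "p \<in> {0..dt} \<times> U" and e: "(0::real) < e"
    obtain t x where tx: "p = (t, x)" "t \<in> {0..dt}" "x \<in> U"
      using p by auto
    obtain r C where r: "0 < r" "0 \<le> C" and
      C: "\<And>s s' y y'. s \<in> {0..dt} \<Longrightarrow> s' \<in> {0..dt} \<Longrightarrow> y \<in> U \<Longrightarrow> y' \<in> U \<Longrightarrow>
       dist t s < r \<Longrightarrow> dist t s' < r \<Longrightarrow> dist x y < r \<Longrightarrow> dist x y' < r \<Longrightarrow>
       norm (?k s y - ?k s' y') \<le> C * (dist s s' + dist y y')"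
      using locally_Lipschitz_feedbackE[OF k dt tx(2,3)] by metis
    define \<delta> where "\<delta> = min r (e / (2 * (C + 1)))"
    have \<delta>: "0 < \<delta>" "\<delta> \<le> r" "C * (2 * \<delta>) < e"
    proof -
      show "0 < \<delta>" "\<delta> \<le> r"
        using r e by (auto simp: \<delta>_def)
      have "C * (2 * \<delta>) \<le> C * (2 * (e / (2 * (C + 1))))"
        using r by (intro mult_left_mono) (auto simp: \<delta>_def)
      also have "\<dots> < e"
        using r e by (simp add: field_simps)
      finally show "C * (2 * \<delta>) < e" .
    qed
    show "\<exists>d>0. \<forall>q\<in>{0..dt} \<times> U. dist q p < d \<longrightarrow> dist (case q of (t, x) \<Rightarrow> ?k t x) (case p of (t, x) \<Rightarrow> ?k t x) < e"
    proof (intro exI[of _ \<delta>] conjI ballI impI)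
      fix q assume "q \<in> {0..dt} \<times> U" and qp: "dist q p < \<delta>"
      then obtain s y where sy: "q = (s, y)" "s \<in> {0..dt}" "y \<in> U"
        by auto
      have near: "dist s t < \<delta>" "dist y x < \<delta>"
        using dist_fst_le[of q p] dist_snd_le[of q p] qp by (auto simp: sy tx)
      have "norm (?k s y - ?k t x) \<le> C * (dist s t + dist y x)"
        using near \<delta> r sy tx by (intro C) (auto simp: dist_commute)
      also have "\<dots> \<le> C * (2 * \<delta>)"
        using near r by (intro mult_left_mono) auto
      also note \<delta>(3)
      finally show "dist (case q of (t, x) \<Rightarrow> ?k t x) (case p of (t, x) \<Rightarrow> ?k t x) < e"
        by (simp add: sy tx dist_norm)
    qed fact
  qed
qed

text \<open>(P2) bounds the feedback near the cells only, so the bound and the location of the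
  closed-loop solution seem to depend on each other. The fixed point theorem breaks this circle: it
  asks for the bound along open-loop solutions with admissible input, and \<open>agent_speed\<close>
  already locates these.\<close>

lemma exists_closed_loop:
  assumes "0 < dt" and x0: "\<And>m. x0 $ m \<in> S (l m)" and S: "\<And>m. S (l m) \<subseteq> D"
    and P: "\<And>m. property_P D S M vmax dt W (pr nbr m l) (K m)" and w: "\<And>m. w m \<in> W"
  shows "\<exists>x. closed_loop_solution D nbr f dt K w x0 x"
proof -
  define k where "k = (\<lambda>m. feedback (K m) (x0 $ m) (w m))"
  define T where "T = (\<lambda>m. horizon (K m) (x0 $ m) (w m))"
  define g where "g = (\<lambda>t x. \<chi> m. k m t (x $ m) (nbr_states nbr m x))"
  have T: "ereal dt < T m" and k: "locally_Lipschitz_feedback D (length (nbr m)) (T m) (k m)" for m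
    using P[of m] x0[of m] w[of m] by (auto simp: property_P_def pr_def k_def T_def Let_def)
  have k_bound: "norm (k m t x xs) \<le> vmax"
    if "0 \<le> t" "t \<le> dt" "x \<in> (S (l m) + cball 0 (dt * (M + vmax))) \<inter> D" "length xs = length (nbr m)"
      "\<And>j. j < length (nbr m) \<Longrightarrow> xs ! j \<in> (S (l (nbr m ! j)) + cball 0 (dt * (M + vmax))) \<inter> D"
    for m t x xs
  proof -
    have "ereal t < T m"
      using le_less_trans[OF _ T, of "ereal t"] that by simp
    then show ?thesis
      using P[of m] x0[of m] w[of m] that unfolding property_P_def pr_def k_def T_def Let_def by auto
  qed
  have x0_U: "x0 \<in> U"
    using x0 S by (auto simp: U_def)
  have "\<exists>x. x 0 = x0 \<and>
    (\<forall>t\<in>{0..dt}. x t \<in> U \<and> (x has_vector_derivative F (x t) + g t (x t)) (at t within {0..dt}))"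
  proof (rule exists_closed_loop_solution[OF x0_U])
    show "local_lipschitz {0..dt} U g"
      by (rule local_lipschitz_vec) (simp add: g_def feedback_regular(1)[OF k T])
    have "continuous_on ({0..dt} \<times> U) (\<lambda>p. \<chi> m. (\<lambda>(t, x). k m t (x $ m) (nbr_states nbr m x)) p)"
      by (intro continuous_on_vec_lambda feedback_regular(2)[OF k T])
    then show "continuous_on ({0..dt} \<times> U) (\<lambda>(t, x). g t x)"
      by (simp add: g_def case_prod_unfold)
    fix v x t assume v: "v \<in> admissible" "solution v x0 x" and t: "t \<in> {0..dt}"
    have x_U: "x t \<in> U"
      using v(2) t by (simp add: solution_def)
    have near: "x t $ m \<in> (S (l m) + cball 0 (dt * (M + vmax))) \<inter> D" for m
    proof -
      have "dist (x0 $ m) (x t $ m) \<le> (M + vmax) * t"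
        using agent_speed[OF v t] .
      also have "\<dots> \<le> dt * (M + vmax)"
        using t vmax by (simp add: mult.commute[of dt] mult_left_mono)
      finally have "x t $ m - x0 $ m \<in> cball 0 (dt * (M + vmax))"
        by (simp add: dist_norm norm_minus_commute)
      then have "x0 $ m + (x t $ m - x0 $ m) \<in> S (l m) + cball 0 (dt * (M + vmax))"
        using x0 by (intro set_plus_intro)
      then show ?thesis
        using x_U by (simp add: U_def)
    qed
    then show "g t (x t) \<in> V"
      using t by (auto simp: V_def g_def intro!: k_bound)
  qed (use \<open>0 < dt\<close> in auto)
  then obtain x where x: "x 0 = x0"
    "\<And>t. t \<in> {0..dt} \<Longrightarrow> x t \<in> U"
    "\<And>t. t \<in> {0..dt} \<Longrightarrow> (x has_vector_derivative F (x t) + g t (x t)) (at t within {0..dt})"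
    by blast
  have "ereal t < T m" if "t \<in> {0..dt}" for t m
    using le_less_trans[OF _ T, of "ereal t"] that by simp
  moreover have "F (x t) + g t (x t) = (\<chi> m. f m (x t $ m) (nbr_states nbr m (x t)) +
                  k m t (x t $ m) (nbr_states nbr m (x t)))" for t
    by (simp add: F_def g_def vec_eq_iff)
  ultimately have "closed_loop_solution D nbr f dt K w x0 x"
    using x unfolding closed_loop_solution_def U_def T_def k_def by auto
  then show ?thesis
    by (intro exI[of _ x])
qed

lemma exists_reference_trajectory:
  assumes p: "p \<in> D" "ps \<in> tuples (length (nbr i)) D" and "0 < dt"
    and small: "L1 * (sqrt (length (nbr i)) * ((M + vmax) * dt)) \<le> vmax"
  shows "\<exists>\<xi>. \<xi> 0 = p \<and>
    (\<forall>t\<in>{0..dt}. \<xi> t \<in> D \<and> (\<xi> has_vector_derivative f i (\<xi> t) ps) (at t within {0..dt}))"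
proof -
  \<comment> \<open>As the neighbors are distinct and do not include \<open>i\<close>, the lookup
    puts the \<open>j\<close>-th neighbor at \<open>ps ! j\<close> and agent \<open>i\<close> at the
    default \<open>p\<close>.\<close>
  define x0 where "x0 = (\<chi> m. case map_of (zip (nbr i) ps) m of Some y \<Rightarrow> y | None \<Rightarrow> p)"
  define h where "h = (\<lambda>x. f i (x $ i) ps - f i (x $ i) (nbr_states nbr i x))"
  define g where "g = (\<lambda>(t::real) x. (\<chi> m. if m = i then h x else 0) :: (real ^ 'n) ^ 'i)"
  have len: "length ps = length (nbr i)" "set ps \<subseteq> D"
    using p by (auto simp: tuples_def)
  have "i \<notin> dom (map_of (zip (nbr i) ps))"
    using nbr(2) len by simp
  then have x0_i: "x0 $ i = p"
    by (simp add: x0_def domIff)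
  have x0_nbr: "nbr_states nbr i x0 ! j = ps ! j" if "j < length (nbr i)" for j
    using that len nbr(1)[of i] by (simp add: x0_def map_of_zip_nth)
  have "x0 $ m \<in> D" for m
    using p(1) len(2) by (auto simp: x0_def split: option.split dest!: map_of_SomeD set_zip_rightD)
  then have x0_U: "x0 \<in> U"
    by (simp add: U_def)
  have h_lipschitz: "norm (h x - h y) \<le> (L2 + (L1 + L2) * sqrt (Suc (length (nbr i)))) * dist x y"
    if "x \<in> U" "y \<in> U" for x y
  proof -
    have "norm (h x - h y) \<le> norm (f i (x $ i) ps - f i (y $ i) ps)
        + norm (f i (x $ i) (nbr_states nbr i x) - f i (y $ i) (nbr_states nbr i y))"
      using norm_triangle_ineq4[of "f i (x $ i) ps - f i (y $ i) ps"
          "f i (x $ i) (nbr_states nbr i x) - f i (y $ i) (nbr_states nbr i y)"]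
      by (simp add: h_def algebra_simps)
    also have "\<dots> \<le> L2 * dist x y + (L1 + L2) * sqrt (Suc (length (nbr i))) * dist x y"
    proof (rule add_mono)
      have "norm (f i (x $ i) ps - f i (y $ i) ps) \<le> L2 * dist (x $ i) (y $ i)"
        using that p by (intro f_lipschitz_self') (auto simp: U_def)
      also have "\<dots> \<le> L2 * dist x y"
        using L2_pos by (intro mult_left_mono dist_vec_nth_le) auto
      finally show "norm (f i (x $ i) ps - f i (y $ i) ps) \<le> L2 * dist x y" .
    qed (rule f_states_lipschitz[OF that])
    finally show ?thesis
      by (simp add: algebra_simps)
  qed
  have h_lip: "(L2 + (L1 + L2) * sqrt (Suc (length (nbr i))))-lipschitz_on U h"
    using h_lipschitz L1_pos L2_pos by (intro lipschitz_onI) (auto simp: dist_norm)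
  have "\<exists>x. x 0 = x0 \<and>
    (\<forall>t\<in>{0..dt}. x t \<in> U \<and> (x has_vector_derivative F (x t) + g t (x t)) (at t within {0..dt}))"
  proof (rule exists_closed_loop_solution[OF x0_U])
    show "local_lipschitz {0..dt} U g"
    proof (rule local_lipschitz_vec)
      fix m
      have "local_lipschitz {0..dt} U (\<lambda>t x. if m = i then h x else 0)"
        using lipschitz_on_subset[OF h_lip]
        by (cases "m = i"; intro local_lipschitzI exI[of _ 1] exI conjI ballI)
          (auto intro!: lipschitz_on_constant)
      then show "local_lipschitz {0..dt} U (\<lambda>t x. g t x $ m)"
        by (simp add: g_def)
    qed
    have "continuous_on ({0..dt} \<times> U) (\<lambda>p. h (snd p))"
      by (intro continuous_on_compose2[OF lipschitz_on_continuous_on[OF h_lip]] continuous_intros) auto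
    then have "continuous_on ({0..dt} \<times> U) (\<lambda>p. if m = i then h (snd p) else 0)" for m
      by (cases "m = i") auto
    then show "continuous_on ({0..dt} \<times> U) (\<lambda>(t, x). g t x)"
      unfolding g_def case_prod_unfold by (intro continuous_on_vec_lambda)
    fix v x t assume v: "v \<in> admissible" "solution v x0 x" and t: "t \<in> {0..dt}"
    have x_U: "x t \<in> U"
      using v(2) t by (simp add: solution_def)
    have "tuple_dist ps (nbr_states nbr i (x t)) \<le> sqrt (length ps) * ((M + vmax) * dt)"
    proof (rule tuple_dist_le)
      fix j assume "j < length ps"
      then have "dist (ps ! j) (nbr_states nbr i (x t) ! j) = dist (x0 $ (nbr i ! j)) (x t $ (nbr i ! j))"
        using x0_nbr[of j] len by simp
      also have "\<dots> \<le> (M + vmax) * t"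
        using agent_speed[OF v t] .
      also have "\<dots> \<le> (M + vmax) * dt"
        using t vmax by (intro mult_left_mono) auto
      finally show "dist (ps ! j) (nbr_states nbr i (x t) ! j) \<le> (M + vmax) * dt" .
    qed (use vmax \<open>0 < dt\<close> in auto)
    then have "L1 * tuple_dist ps (nbr_states nbr i (x t)) \<le> L1 * (sqrt (length (nbr i)) * ((M + vmax) * dt))"
      using L1_pos len by (intro mult_left_mono) auto
    moreover have "norm (h (x t)) \<le> L1 * tuple_dist ps (nbr_states nbr i (x t))"
      unfolding h_def using p x_U by (intro f_lipschitz_nbr' nbr_states_tuples) (auto simp: U_def)
    ultimately have "norm (h (x t)) \<le> vmax"
      using small by linarith
    then show "g t (x t) \<in> V"
      using vmax by (simp add: V_def g_def)
  qed (use \<open>0 < dt\<close> in auto)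
  then obtain x where x: "x 0 = x0"
    "\<And>t. t \<in> {0..dt} \<Longrightarrow> x t \<in> U"
    "\<And>t. t \<in> {0..dt} \<Longrightarrow> (x has_vector_derivative F (x t) + g t (x t)) (at t within {0..dt})"
    by blast
  have "((\<lambda>t. x t $ i) has_vector_derivative f i (x t $ i) ps) (at t within {0..dt})" if "t \<in> {0..dt}" for t
    using bounded_linear.has_vector_derivative[OF bounded_linear_vec_nth x(3)[OF that], of i]
    by (simp add: F_def g_def h_def)
  then show ?thesis
    using x x0_i by (intro exI[of _ "\<lambda>t. x t $ i"]) (auto simp: U_def)
qed

end

section \<open>Transitions and their number\<close>

locale cell_abstraction = multi_agent_system D nbr f M vmax L1 L2
  for D :: "(real ^ 'n) set"
    and nbr :: "'i::finite \<Rightarrow> 'i list"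
    and f :: "'i \<Rightarrow> real ^ 'n \<Rightarrow> (real ^ 'n) list \<Rightarrow> real ^ 'n"
    and M vmax L1 L2 :: real +
  fixes I :: "'l set" and S :: "'l \<Rightarrow> (real ^ 'n) set" and dt lam dmax :: real
  assumes cells: "cell_decomposition D I S"
    and cell_dist: "\<And>l x y. l \<in> I \<Longrightarrow> x \<in> S l \<Longrightarrow> y \<in> S l \<Longrightarrow> dist x y \<le> dmax"
    and dt: "0 < dt" and lam: "0 < lam" "lam < 1" and dmax: "0 < dmax"
    and budget: "\<And>i. (3 * L2 + 4 * L1 * sqrt (length (nbr i))) * M * dt + dmax / dt \<le> (1 - lam) * vmax"
begin

abbreviation W :: "(real ^ 'n) set" where
  "W \<equiv> cball 0 (lam * vmax)"

definition point :: "'l \<Rightarrow> real ^ 'n" where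
  "point l = (SOME x. x \<in> S l)"

lemma cell_subset: "l \<in> I \<Longrightarrow> S l \<subseteq> D"
  using cells by (auto simp: cell_decomposition_def)

lemma point_in_cell: "l \<in> I \<Longrightarrow> point l \<in> S l"
  using cells unfolding cell_decomposition_def point_def by (metis some_in_eq)

lemma M_pos: "0 < M"
  using vmax by linarith

lemma dmax_le: "dmax \<le> (1 - lam) * vmax * dt"
proof -
  have "0 \<le> (3 * L2 + 4 * L1 * sqrt (length (nbr undefined))) * M * dt"
    using L1_pos L2_pos M_pos dt by simp
  then have "dmax / dt \<le> (1 - lam) * vmax"
    using budget[of undefined] by linarith
  then show ?thesis
    using dt by (simp add: pos_divide_le_eq)
qed

text \<open>The summands bound the parts of \<open>law\<close>: compensation of the neighbors,
  removal of the offset, \<open>w\<close>, and the truncated term. From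
  \<open>dmax + lam * vmax * dt \<le> vmax * dt \<le> M * dt\<close> the two distances are at most
  \<open>3 * (M * dt)\<close> and \<open>M * dt\<close>, which the coefficients of \<open>L1\<close>
  and \<open>L2\<close> in \<open>budget\<close> cover.\<close>

lemma budget_law:
  "L1 * (sqrt (length (nbr i)) * (dmax + dt * (M + vmax))) + dmax / dt + lam * vmax
     + L2 * (dmax + lam * vmax * dt) \<le> vmax"
proof -
  let ?N = "sqrt (length (nbr i))"
  have vM: "vmax * dt \<le> M * dt"
    using vmax dt by (intro mult_right_mono) auto
  have sum_le: "dmax + lam * vmax * dt \<le> vmax * dt"
    using dmax_le by (simp add: algebra_simps)
  then have "L2 * (dmax + lam * vmax * dt) \<le> L2 * (M * dt)"
    using vM L2_pos by (intro mult_left_mono) auto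
  moreover have "0 \<le> lam * vmax * dt"
    using lam vmax dt by simp
  then have "dmax \<le> M * dt"
    using sum_le vM by linarith
  then have "dmax + dt * (M + vmax) \<le> 3 * (M * dt)"
    using vM by (simp add: algebra_simps)
  then have "L1 * (?N * (dmax + dt * (M + vmax))) \<le> L1 * (?N * (3 * (M * dt)))"
    using L1_pos by (intro mult_left_mono) auto
  moreover have "0 \<le> 2 * L2 * M * dt + L1 * ?N * M * dt"
    using L1_pos L2_pos M_pos dt by simp
  ultimately show ?thesis
    using budget[of i] by (simp add: algebra_simps)
qed

lemma budget_reference: "L1 * (sqrt (length (nbr i)) * ((M + vmax) * dt)) \<le> vmax"
proof -
  have "L1 * (sqrt (length (nbr i)) * ((M + vmax) * dt)) \<le> L1 * (sqrt (length (nbr i)) * (dmax + dt * (M + vmax)))"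
    using L1_pos dmax by (intro mult_left_mono) (auto simp: mult.commute)
  moreover have "0 \<le> dmax / dt + lam * vmax + L2 * (dmax + lam * vmax * dt)"
    using dmax dt lam vmax L2_pos by simp
  ultimately show ?thesis
    using budget_law[of i] by linarith
qed

text \<open>On the intended path the deviation from \<open>\<xi>\<close> consists of a fraction of
  the offset, at most \<open>dmax\<close>, and of \<open>t * w\<close>, at most
  \<open>lam * vmax * dt\<close>. The factor \<open>L2\<close> converts this into a difference of
  values of \<open>f\<close>.\<close>

abbreviation radius :: real where
  "radius \<equiv> L2 * (dmax + lam * vmax * dt)"

lemma radius_nonneg: "0 \<le> radius"
  using L2_pos dmax lam vmax dt by simp

text \<open>
  With this law agent \<open>i\<close> follows \<open>\<xi> t + (1 - t / dt) * (x0 - p) + t * w\<close>, which ends in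
  \<open>\<xi> dt + dt * w\<close> whatever \<open>x0\<close> and the neighbors do. The last summand would naturally be
  \<open>f i (\<xi> t) ps - f i (y t) ps\<close> along that path \<open>y\<close>, but \<open>y\<close> is not known in advance to stay in \<open>D\<close>.
  The feedback is therefore evaluated at \<open>x\<close> and truncated at a bound that \<open>y\<close> respects.
\<close>

definition law :: "'i \<Rightarrow> real ^ 'n \<Rightarrow> (real ^ 'n) list \<Rightarrow> (real \<Rightarrow> real ^ 'n) \<Rightarrow> 'n feedback_law" where
  "law i p ps \<xi> = \<lparr>horizon = \<lambda>_ _. \<infinity>,
     feedback = \<lambda>x0 w t x xs. f i x ps - f i x xs + (p - x0) /\<^sub>R dt + w
       + closest_point (cball 0 radius) (f i (\<xi> (min t dt)) ps - f i x ps)\<rparr>"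

lemma closest_point_cball_radius:
  "dist (closest_point (cball 0 radius) q) (closest_point (cball 0 radius) q') \<le> dist q q'"
  "norm (closest_point (cball 0 radius) q) \<le> radius"
  for q q' :: "real ^ 'n"
proof -
  show "dist (closest_point (cball 0 radius) q) (closest_point (cball 0 radius) q') \<le> dist q q'"
    using radius_nonneg by (intro closest_point_lipschitz) auto
  show "norm (closest_point (cball 0 radius) q) \<le> radius"
    using closest_point_in_set[of "cball 0 radius" q] radius_nonneg by (simp add: cball_eq_empty)
qed

text \<open>Beyond \<open>dt\<close> nothing is known of \<open>\<xi>\<close> although the horizon
  is infinite, hence the clamped time \<open>min t dt\<close> in \<open>law\<close>. Projection onto
  a ball is nonexpansive, so truncation preserves Lipschitz continuity.\<close>

lemma law_locally_Lipschitz: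
  assumes ps: "ps \<in> tuples (length (nbr i)) D"
    and \<xi>: "\<And>t. t \<in> {0..dt} \<Longrightarrow> \<xi> t \<in> D \<and> (\<xi> has_vector_derivative f i (\<xi> t) ps) (at t within {0..dt})"
  shows "locally_Lipschitz_feedback D (length (nbr i)) T (feedback (law i p ps \<xi>) x0 w)"
proof -
  let ?k = "feedback (law i p ps \<xi>) x0 w"
  \<comment> \<open>Below, \<open>a\<close> (twice, once inside the truncation), \<open>b\<close>
    and \<open>c\<close> contribute \<open>2 * L2\<close>, \<open>L1 + L2\<close> and
    \<open>L2 * M\<close>; the last stems from the speed bound \<open>M\<close> of
    \<open>\<xi>\<close>.\<close>
  define C where "C = L2 * M + 3 * L2 + L1"
  have "norm (?k t x xs - ?k s y ys) \<le> C * sqrt ((t - s)\<^sup>2 + (tuple_dist (x # xs) (y # ys))\<^sup>2)"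
    if "0 \<le> t" "0 \<le> s" "x \<in> D" "y \<in> D" "xs \<in> tuples (length (nbr i)) D" "ys \<in> tuples (length (nbr i)) D"
    for t s x y xs ys
  proof -
    define d where "d = sqrt ((t - s)\<^sup>2 + (tuple_dist (x # xs) (y # ys))\<^sup>2)"
    have ts: "min t dt \<in> {0..dt}" "min s dt \<in> {0..dt}"
      using that dt by auto
    have "\<bar>t - s\<bar> \<le> d" and td: "tuple_dist (x # xs) (y # ys) \<le> d"
      by (auto simp: d_def intro: real_le_rsqrt)
    have xy: "dist x y \<le> d"
      using tuple_dist_Cons_ge(1) td by (rule order_trans)
    have "dist (\<xi> (min t dt)) (\<xi> (min s dt)) \<le> M * dist (min t dt) (min s dt)"
      using \<xi> ts ps by (intro dist_le_speed[of dt \<xi> "\<lambda>t. f i (\<xi> t) ps"] f_bound) auto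
    also have "\<dots> \<le> M * d"
      using \<open>\<bar>t - s\<bar> \<le> d\<close> M_pos by (intro mult_left_mono) (auto simp: dist_real_def min_def)
    finally have \<xi>_dist: "dist (\<xi> (min t dt)) (\<xi> (min s dt)) \<le> M * d" .
    define a b c q q' where "a = f i x ps - f i y ps" and "b = f i x xs - f i y ys"
      and "c = f i (\<xi> (min t dt)) ps - f i (\<xi> (min s dt)) ps"
      and "q = f i (\<xi> (min t dt)) ps - f i x ps" and "q' = f i (\<xi> (min s dt)) ps - f i y ps"
    let ?P = "closest_point (cball 0 radius)"
    have "norm a \<le> L2 * dist x y"
      unfolding a_def using that ps by (intro f_lipschitz_self')
    also have "\<dots> \<le> L2 * d"
      using xy L2_pos by (intro mult_left_mono) auto
    finally have a: "norm a \<le> L2 * d" .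
    have "norm b \<le> (L1 + L2) * tuple_dist (x # xs) (y # ys)"
      unfolding b_def using that by (intro f_lipschitz)
    also have "\<dots> \<le> (L1 + L2) * d"
      using td L1_pos L2_pos by (intro mult_left_mono) auto
    finally have b: "norm b \<le> (L1 + L2) * d" .
    have "norm c \<le> L2 * dist (\<xi> (min t dt)) (\<xi> (min s dt))"
      unfolding c_def using \<xi> ts ps by (intro f_lipschitz_self') auto
    also have "\<dots> \<le> L2 * (M * d)"
      using \<xi>_dist L2_pos by (intro mult_left_mono) auto
    finally have c: "norm c \<le> L2 * (M * d)" .
    have "norm (?P q - ?P q') \<le> norm (q - q')"
      using closest_point_cball_radius(1)[of q q'] by (simp add: dist_norm)
    also have "q - q' = c - a"
      by (simp add: q_def q'_def c_def a_def)
    finally have P: "norm (?P q - ?P q') \<le> norm c + norm a"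
      using norm_triangle_ineq4[of c a] by linarith
    have "?k t x xs - ?k s y ys = a - b + (?P q - ?P q')"
      by (simp add: law_def a_def b_def q_def q'_def)
    then have "norm (?k t x xs - ?k s y ys) \<le> norm a + norm b + norm (?P q - ?P q')"
      using norm_triangle_ineq[of "a - b" "?P q - ?P q'"] norm_triangle_ineq4[of a b] by simp
    also have "\<dots> \<le> C * d"
      using a b c P by (simp add: C_def algebra_simps)
    finally show ?thesis
      by (simp add: d_def)
  qed
  then show ?thesis
    unfolding locally_Lipschitz_feedback_def Let_def
    by (intro ballI exI[of _ 1] conjI exI[of _ C]) auto
qed

text \<open>(P2) concerns all states in the enlarged cells, also those far from the intended path.
  There the truncation still bounds the last summand by \<open>radius\<close>, and
  \<open>budget_law\<close> adds up the parts.\<close>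

lemma law_property_P:
  assumes l: "li \<in> I" "ls \<in> tuples (length (nbr i)) I"
    and \<xi>: "\<xi> 0 = point li" "\<And>t. t \<in> {0..dt} \<Longrightarrow> \<xi> t \<in> D \<and>
      (\<xi> has_vector_derivative f i (\<xi> t) (map point ls)) (at t within {0..dt})"
  shows "property_P D S M vmax dt W (li, ls) (law i (point li) (map point ls) \<xi>)"
proof -
  let ?ps = "map point ls" and ?R = "dt * (M + vmax)"
  let ?K = "law i (point li) ?ps \<xi>"
  have ls: "length ls = length (nbr i)" "\<And>j. j < length ls \<Longrightarrow> ls ! j \<in> I"
    using l(2) by (auto simp: tuples_def)
  have ps: "?ps \<in> tuples (length (nbr i)) D"
    using l(2) point_in_cell cell_subset by (force simp: tuples_def)
  have "norm (feedback ?K x0 w t x xs) \<le> vmax"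
    if x0: "x0 \<in> S li" and w: "w \<in> W"
      and x: "x \<in> (S li + cball 0 ?R) \<inter> D" "length xs = length ls"
      and xs: "\<And>j. j < length ls \<Longrightarrow> xs ! j \<in> (S (ls ! j) + cball 0 ?R) \<inter> D"
    for x0 w t x xs
  proof -
    let ?q = "f i (\<xi> (min t dt)) ?ps - f i x ?ps"
    have xs_D: "xs \<in> tuples (length (nbr i)) D"
      using xs x(2) ls(1) by (auto simp: tuples_def in_set_conv_nth)
    have "tuple_dist ?ps xs \<le> sqrt (length ?ps) * (dmax + ?R)"
    proof (rule tuple_dist_le)
      fix j assume "j < length ?ps"
      then have j: "j < length ls"
        by simp
      obtain y z where yz: "xs ! j = y + z" "y \<in> S (ls ! j)" "norm z \<le> ?R"
        using xs[OF j] by (auto elim!: set_plus_elim)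
      have "dist (point (ls ! j)) y \<le> dmax"
        using cell_dist[OF ls(2)[OF j]] point_in_cell[OF ls(2)[OF j]] yz by simp
      moreover have "dist y (y + z) \<le> ?R"
        using yz by (simp add: dist_norm)
      ultimately have "dist (point (ls ! j)) (y + z) \<le> dmax + ?R"
        using dist_triangle[of "point (ls ! j)" "y + z" y] by linarith
      then show "dist (?ps ! j) (xs ! j) \<le> dmax + ?R"
        using j yz by simp
    qed (use dmax dt vmax in auto)
    then have "L1 * tuple_dist ?ps xs \<le> L1 * (sqrt (length (nbr i)) * (dmax + ?R))"
      using L1_pos ls(1) by (intro mult_left_mono) auto
    moreover have "norm (f i x ?ps - f i x xs) \<le> L1 * tuple_dist ?ps xs"
      using x ps xs_D by (intro f_lipschitz_nbr') auto
    moreover have "norm ((point li - x0) /\<^sub>R dt) \<le> dmax / dt"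
      using cell_dist[OF l(1) point_in_cell[OF l(1)] x0] dt
      by (simp add: dist_norm divide_inverse mult.commute mult_right_mono del: scaleR_right_diff_distrib)
    moreover have "norm w \<le> lam * vmax"
      using w by simp
    moreover have "norm (closest_point (cball 0 radius) ?q) \<le> radius"
      by (rule closest_point_cball_radius)
    moreover have "norm (feedback ?K x0 w t x xs) \<le> norm (f i x ?ps - f i x xs)
        + norm ((point li - x0) /\<^sub>R dt) + norm w + norm (closest_point (cball 0 radius) ?q)"
      unfolding law_def feedback_law.select_convs
      by (intro order_trans[OF norm_triangle_ineq] add_mono order_refl)
    ultimately show ?thesis
      using budget_law[of i] by linarith
  qed
  moreover have "locally_Lipschitz_feedback D (length ls) (horizon ?K x0 w) (feedback ?K x0 w)" for x0 w
    using law_locally_Lipschitz[OF ps \<xi>(2)] ls(1) by simp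
  moreover have "horizon ?K x0 w = \<infinity>" for x0 w
    by (simp add: law_def)
  ultimately show ?thesis
    unfolding property_P_def Let_def by simp
qed

text \<open>\<open>y\<close> is the deviation from the intended path \<open>\<xi> + e\<close>. Its
  derivative is the truncation error \<open>?P (q t) - q t\<close>, and \<open>q t\<close> exceeds
  \<open>radius\<close> by at most \<open>L2 * norm (y t)\<close>; so \<open>y\<close> obeys a
  linear inequality with \<open>y 0 = 0\<close> and vanishes. Only \<open>\<xi> t\<close> and the
  actual state enter \<open>f\<close>, and both lie in \<open>D\<close>.\<close>

lemma law_endpoint:
  assumes l: "li \<in> I" and ps: "ps \<in> tuples (length (nbr i)) D"
    and \<xi>: "\<xi> 0 = point li" "\<And>t. t \<in> {0..dt} \<Longrightarrow> \<xi> t \<in> D \<and>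
      (\<xi> has_vector_derivative f i (\<xi> t) ps) (at t within {0..dt})"
    and sol: "closed_loop_solution D nbr f dt K w x0 x" and K: "K i = law i (point li) ps \<xi>"
    and w: "w i \<in> W" and x0: "x0 $ i \<in> S li"
  shows "x dt $ i = \<xi> dt + dt *\<^sub>R w i"
proof -
  let ?p = "point li"
  let ?P = "closest_point (cball 0 radius)"
  define e where "e t = (1 - t / dt) *\<^sub>R (x0 $ i - ?p) + t *\<^sub>R w i" for t
  define y where "y t = x t $ i - \<xi> t - e t" for t
  define q where "q t = f i (\<xi> t) ps - f i (x t $ i) ps" for t
  have x_D: "x t $ m \<in> D" if "t \<in> {0..dt}" for t m
    using sol that by (auto simp: closed_loop_solution_def)
  have y_deriv: "(y has_vector_derivative ?P (q t) - q t) (at t within {0..dt})" if t: "t \<in> {0..dt}" for t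
  proof -
    have "(x has_vector_derivative (\<chi> m. f m (x t $ m) (nbr_states nbr m (x t)) +
                  feedback (K m) (x0 $ m) (w m) t (x t $ m) (nbr_states nbr m (x t)))) (at t within {0..dt})"
      using sol t by (auto simp: closed_loop_solution_def)
    from bounded_linear.has_vector_derivative[OF bounded_linear_vec_nth this, of i]
    have 1: "((\<lambda>t. x t $ i) has_vector_derivative
        f i (x t $ i) ps + (?p - x0 $ i) /\<^sub>R dt + w i + ?P (q t)) (at t within {0..dt})"
      using t by (simp add: K law_def q_def algebra_simps)
    have 2: "(e has_vector_derivative (- (1 / dt)) *\<^sub>R (x0 $ i - ?p) + w i) (at t within {0..dt})"
      unfolding e_def has_vector_derivative_def using dt
      by (auto intro!: derivative_eq_intros simp: algebra_simps)
    show ?thesis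
      using has_vector_derivative_diff[OF has_vector_derivative_diff[OF 1] 2, of \<xi> "f i (\<xi> t) ps"] \<xi>(2)[OF t]
      unfolding y_def by (simp add: q_def algebra_simps divide_inverse)
  qed
  have "norm (?P (q t) - q t) \<le> L2 * norm (y t)" if t: "t \<in> {0..dt}" for t
  proof (rule norm_closest_point_cball_diff_le)
    have "norm (e t) \<le> norm ((1 - t / dt) *\<^sub>R (x0 $ i - ?p)) + norm (t *\<^sub>R w i)"
      unfolding e_def by (rule norm_triangle_ineq)
    also have "\<dots> \<le> 1 * dmax + dt * (lam * vmax)"
    proof (rule add_mono)
      have "\<bar>1 - t / dt\<bar> \<le> 1"
        using t dt by auto
      then show "norm ((1 - t / dt) *\<^sub>R (x0 $ i - ?p)) \<le> 1 * dmax"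
        using cell_dist[OF l x0 point_in_cell[OF l]] unfolding norm_scaleR
        by (intro mult_mono) (auto simp: dist_norm)
      show "norm (t *\<^sub>R w i) \<le> dt * (lam * vmax)"
        using t w unfolding norm_scaleR by (intro mult_mono) auto
    qed
    finally have e: "norm (e t) \<le> dmax + lam * vmax * dt"
      by (simp add: mult_ac)
    have "norm (q t) \<le> L2 * dist (\<xi> t) (x t $ i)"
      unfolding q_def using \<xi>(2)[OF t] x_D[OF t] ps by (intro f_lipschitz_self') auto
    also have "dist (\<xi> t) (x t $ i) = norm (y t + e t)"
      by (simp add: y_def dist_norm norm_minus_commute)
    also have "L2 * norm (y t + e t) \<le> L2 * (norm (y t) + (dmax + lam * vmax * dt))"
      using L2_pos e by (intro mult_left_mono norm_triangle_le add_mono) auto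
    finally show "norm (q t) \<le> radius + L2 * norm (y t)"
      by (simp add: algebra_simps)
  qed (use radius_nonneg L2_pos in auto)
  then have "norm (y dt) \<le> exp (L2 * dt) * norm (y 0)"
    using dt by (intro gronwall_upper[OF y_deriv]) auto
  moreover have "y 0 = 0"
    using sol \<xi>(1) by (simp add: y_def e_def closed_loop_solution_def)
  ultimately have "y dt = 0"
    by simp
  then show ?thesis
    using dt by (simp add: y_def e_def algebra_simps)
qed

section \<open>From the feedback law to the number of transitions\<close>

lemma exists_configuration:
  assumes "c \<in> cell_configs nbr I i"
  shows "\<exists>l. range l \<subseteq> I \<and> pr nbr i l = c"
proof -
  obtain li ls where c: "c = (li, ls)" "li \<in> I" "length ls = length (nbr i)" "set ls \<subseteq> I"
    using assms by (auto simp: cell_configs_def tuples_def)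
  define l where "l = (\<lambda>m. case map_of (zip (nbr i) ls) m of Some k \<Rightarrow> k | None \<Rightarrow> li)"
  have "i \<notin> dom (map_of (zip (nbr i) ls))"
    using nbr(2) c by simp
  then have "l i = li"
    by (simp add: l_def domIff)
  moreover have "map l (nbr i) = ls"
    using c nbr(1)[of i] by (intro nth_equalityI) (auto simp: l_def map_of_zip_nth)
  moreover have "range l \<subseteq> I"
    using c by (auto simp: l_def split: option.split dest!: map_of_SomeD set_zip_rightD)
  ultimately show ?thesis
    using c by (auto simp: pr_def)
qed

text \<open>Supplies the other agents with a law when a concrete run of the closed loop is
  required.\<close>

lemma zero_law_property_P:
  "property_P D S M vmax dt W c \<lparr>horizon = \<lambda>_ _. \<infinity>, feedback = \<lambda>_ _ _ _ _. 0\<rparr>"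
proof -
  have "locally_Lipschitz_feedback D m T (\<lambda>_ _ _. 0)" for m T
    unfolding locally_Lipschitz_feedback_def Let_def
    by (intro ballI exI[of _ "1 :: real"] conjI exI[of _ "0 :: real"]) auto
  then show ?thesis
    using vmax by (simp add: property_P_def split: prod.split)
qed

lemma ball_subset_Post_cells:
  assumes c: "c \<in> cell_configs nbr I i"
  shows "\<exists>z. cball z (lam * vmax * dt) \<subseteq> (\<Union>l'\<in>Post D nbr f I S M vmax dt W i c. S l')"
proof -
  obtain li ls where l: "c = (li, ls)" "li \<in> I" "ls \<in> tuples (length (nbr i)) I"
    using c by (auto simp: cell_configs_def)
  let ?ps = "map point ls"
  have ps: "?ps \<in> tuples (length (nbr i)) D"
    using l(3) point_in_cell cell_subset by (force simp: tuples_def)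
  have p: "point li \<in> D"
    using l(2) point_in_cell cell_subset by blast
  obtain \<xi> where \<xi>: "\<xi> 0 = point li" "\<And>t. t \<in> {0..dt} \<Longrightarrow> \<xi> t \<in> D \<and>
      (\<xi> has_vector_derivative f i (\<xi> t) ?ps) (at t within {0..dt})"
    using exists_reference_trajectory[OF p ps dt budget_reference] by blast
  let ?K = "law i (point li) ?ps \<xi>"
  have P: "property_P D S M vmax dt W c ?K"
    using law_property_P[OF l(2,3) \<xi>] l(1) by simp
  have "y \<in> (\<Union>l'\<in>Post D nbr f I S M vmax dt W i c. S l')"
    if y: "y \<in> cball (\<xi> dt) (lam * vmax * dt)" for y
  proof -
    define u where "u = (y - \<xi> dt) /\<^sub>R dt"
    have u: "u \<in> W" "\<xi> dt + dt *\<^sub>R u = y"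
    proof -
      have "norm u = norm (y - \<xi> dt) / dt"
        using dt by (simp add: u_def divide_inverse)
      then show "u \<in> W"
        using y dt by (simp add: dist_norm norm_minus_commute pos_divide_le_eq)
      show "\<xi> dt + dt *\<^sub>R u = y"
        using dt by (simp add: u_def)
    qed
    have run: "(\<exists>x. closed_loop_solution D nbr f dt K w x0 x) \<and>
        (\<forall>x. closed_loop_solution D nbr f dt K w x0 x \<longrightarrow> x dt $ i = y)"
      if "range l \<subseteq> I" "pr nbr i l = c" "K i = ?K" "w i = u"
        "\<forall>m. m \<noteq> i \<longrightarrow> property_P D S M vmax dt W (pr nbr m l) (K m) \<and> w m \<in> W"
        "\<forall>m. x0 $ m \<in> S (l m)"
      for l K w x0
    proof
      have laws: "property_P D S M vmax dt W (pr nbr m l) (K m)" "w m \<in> W" for m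
        using that(2-5) P u(1) by (cases "m = i"; simp)+
      have "S (l m) \<subseteq> D" for m
        using that(1) by (intro cell_subset) auto
      with that(6) show "\<exists>x. closed_loop_solution D nbr f dt K w x0 x"
        by (intro exists_closed_loop[OF dt _ _ laws]) simp_all
      have "l i = li"
        using that(2) l(1) by (simp add: pr_def)
      have "x dt $ i = y" if sol: "closed_loop_solution D nbr f dt K w x0 x" for x
      proof -
        have "x dt $ i = \<xi> dt + dt *\<^sub>R w i"
          using laws(2) \<open>K i = ?K\<close> \<open>l i = li\<close> spec[OF \<open>\<forall>m. x0 $ m \<in> S (l m)\<close>, of i]
          by (intro law_endpoint[OF l(2) ps \<xi> sol]) simp_all
        then show ?thesis
          using u(2) \<open>w i = u\<close> by simp
      qed
      then show "\<forall>x. closed_loop_solution D nbr f dt K w x0 x \<longrightarrow> x dt $ i = y"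
        by blast
    qed
    \<comment> \<open>A cell containing \<open>y\<close> exists only if \<open>y\<close> lies in
      \<open>D\<close>. A concrete run settles this: \<open>c\<close> is extended to all agents,
      they start at the reference points, and the others use the zero law; the solution stays in
      \<open>D\<close> and agent \<open>i\<close> ends in \<open>y\<close>.\<close>
    have "y \<in> D"
    proof -
      obtain l where l': "range l \<subseteq> I" "pr nbr i l = c"
        using exists_configuration[OF c] by blast
      define K where "K m = (if m = i then ?K else \<lparr>horizon = \<lambda>_ _. \<infinity>, feedback = \<lambda>_ _ _ _ _. 0\<rparr>)" for m
      have "(\<chi> m. point (l m)) $ m \<in> S (l m)" for m
        using l' by (auto intro!: point_in_cell)
      then obtain x where "closed_loop_solution D nbr f dt K (\<lambda>m. u) (\<chi> m. point (l m)) x" "x dt $ i = y"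
        using run[OF l', of K "\<lambda>m. u" "\<chi> m. point (l m)"] u(1) zero_law_property_P
        unfolding K_def by fastforce
      then show ?thesis
        using dt by (auto simp: closed_loop_solution_def)
    qed
    moreover have "(\<Union>l\<in>I. S l) = D"
      using cells by (simp add: cell_decomposition_def)
    ultimately obtain l' where l': "l' \<in> I" "y \<in> S l'"
      by blast
    have "condition_C D nbr f I S M vmax dt W i c ?K u l'"
      unfolding condition_C_def
    proof (intro allI impI, elim conjE)
      fix l K w x0
      assume *: "range l \<subseteq> I" "pr nbr i l = c" "K i = ?K" "w i = u"
        "\<forall>m. m \<noteq> i \<longrightarrow> property_P D S M vmax dt W (pr nbr m l) (K m) \<and> w m \<in> W"
        "\<forall>m. x0 $ m \<in> S (l m)"
      show "(\<exists>x. closed_loop_solution D nbr f dt K w x0 x) \<and>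
          (\<forall>x. closed_loop_solution D nbr f dt K w x0 x \<longrightarrow> x dt $ i \<in> S l')"
        using run[OF *] l'(2) by simp
    qed
    then have "l' \<in> Post D nbr f I S M vmax dt W i c"
      using l'(1) P u(1) unfolding Post_def well_posed_transition_def by blast
    then show ?thesis
      using l'(2) by blast
  qed
  then show ?thesis
    by blast
qed

lemma emeasure_cell_le:
  assumes "l \<in> I"
  shows "S l \<in> sets borel" "emeasure lborel (S l) \<le> emeasure lborel (cball (0 :: real ^ 'n) (dmax / 2))"
proof -
  have "S l = closure (interior (S l)) \<inter> D"
    using cells assms by (auto simp: cell_decomposition_def)
  moreover have "closure (interior (S l)) \<inter> D \<in> sets borel"
    using open_D by (intro sets.Int borel_closed borel_open) auto
  ultimately show "S l \<in> sets borel"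
    by simp
  then show "emeasure lborel (S l) \<le> emeasure lborel (cball (0 :: real ^ 'n) (dmax / 2))"
    using cell_dist[OF assms] dmax by (rule isodiametric)
qed

theorem card_Post_ge:
  assumes c: "c \<in> cell_configs nbr I i" and fin: "finite (Post D nbr f I S M vmax dt W i c)"
    and mu: "0 < mu" "mu * dmax \<le> 2 * lam * vmax * dt"
  shows "mu ^ CARD('n) \<le> card (Post D nbr f I S M vmax dt W i c)"
proof -
  let ?Post = "Post D nbr f I S M vmax dt W i c"
  let ?V = "unit_ball_vol (CARD('n))"
  obtain z where z: "cball z (lam * vmax * dt) \<subseteq> (\<Union>l\<in>?Post. S l)"
    using ball_subset_Post_cells[OF c] by blast
  have Post_I: "?Post \<subseteq> I"
    by (auto simp: Post_def)
  have half: "0 \<le> mu * (dmax / 2)"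
    using mu dmax by simp
  have "ennreal (?V * (mu * (dmax / 2)) ^ CARD('n)) = emeasure lborel (cball z (mu * (dmax / 2)))"
    using half by (simp add: emeasure_cball)
  also have "\<dots> \<le> emeasure lborel (\<Union>l\<in>?Post. S l)"
  proof (rule emeasure_mono)
    have "cball z (mu * (dmax / 2)) \<subseteq> cball z (lam * vmax * dt)"
      using mu by auto
    then show "cball z (mu * (dmax / 2)) \<subseteq> (\<Union>l\<in>?Post. S l)"
      using z by blast
    show "(\<Union>l\<in>?Post. S l) \<in> sets lborel"
      using fin Post_I emeasure_cell_le(1) by (intro sets.finite_UN) auto
  qed
  also have "\<dots> \<le> (\<Sum>l\<in>?Post. emeasure lborel (S l))"
    using fin Post_I emeasure_cell_le(1) by (intro emeasure_subadditive_finite) auto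
  also have "\<dots> \<le> (\<Sum>l\<in>?Post. emeasure lborel (cball (0 :: real ^ 'n) (dmax / 2)))"
    using Post_I by (intro sum_mono emeasure_cell_le(2)) auto
  also have "\<dots> = ennreal (card ?Post * (?V * (dmax / 2) ^ CARD('n)))"
    using dmax by (simp add: emeasure_cball ennreal_mult' ennreal_of_nat_eq_real_of_nat)
  finally have "?V * (mu * (dmax / 2)) ^ CARD('n) \<le> card ?Post * (?V * (dmax / 2) ^ CARD('n))"
    using dmax by (simp add: ennreal_le_iff)
  then have "mu ^ CARD('n) * (?V * (dmax / 2) ^ CARD('n)) \<le> card ?Post * (?V * (dmax / 2) ^ CARD('n))"
    by (simp only: power_mult_distrib mult_ac)
  moreover have "0 < ?V * (dmax / 2) ^ CARD('n)"
    using dmax by (intro mult_pos_pos unit_ball_vol_pos) auto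
  ultimately show ?thesis
    by (simp only: mult_le_cancel_right_pos)
qed

end

section \<open>Reduction of the parameter cases to two inequalities\<close>

lemma quadratic_le_zero_iff:
  fixes a b c t :: real
  assumes "0 < a"
  shows "a * t\<^sup>2 - b * t + c \<le> 0 \<longleftrightarrow> (2 * a * t - b)\<^sup>2 \<le> b\<^sup>2 - 4 * a * c"
proof -
  have "(2 * a * t - b)\<^sup>2 - (b\<^sup>2 - 4 * a * c) = 4 * a * (a * t\<^sup>2 - b * t + c)"
    by (simp add: power2_eq_square algebra_simps)
  then have "(2 * a * t - b)\<^sup>2 \<le> b\<^sup>2 - 4 * a * c \<longleftrightarrow> 4 * a * (a * t\<^sup>2 - b * t + c) \<le> 0"
    by linarith
  also have "\<dots> \<longleftrightarrow> a * t\<^sup>2 - b * t + c \<le> 0"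
    using assms by (simp add: mult_le_0_iff)
  finally show ?thesis by simp
qed

text \<open>The sublevel set of a convex quadratic is an interval; \<open>t0\<close> lies in it and
  the bound on \<open>t\<close> from above is its right end. In the applications \<open>t0\<close>
  is the left root under (b) and the lower bound of \<open>dt\<close> under (d).\<close>

lemma quadratic_le_zero_between:
  fixes a b c t :: real
  assumes "0 < a" "(2 * a * t0 - b)\<^sup>2 \<le> b\<^sup>2 - 4 * a * c" "t0 \<le> t" "t \<le> (b + sqrt (b\<^sup>2 - 4 * a * c)) / (2 * a)"
  shows "a * t\<^sup>2 - b * t + c \<le> 0"
proof -
  have "\<bar>2 * a * t0 - b\<bar> \<le> sqrt (b\<^sup>2 - 4 * a * c)"
    using assms(2) by (metis real_sqrt_abs real_sqrt_le_iff)
  moreover have "2 * a * t0 \<le> 2 * a * t" "2 * a * t - b \<le> sqrt (b\<^sup>2 - 4 * a * c)"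
    using assms by (auto simp: field_simps)
  ultimately have "\<bar>2 * a * t - b\<bar> \<le> sqrt (b\<^sup>2 - 4 * a * c)"
    by linarith
  moreover have "0 \<le> b\<^sup>2 - 4 * a * c"
    using assms(2) zero_le_power2 order_trans by blast
  ultimately have "(2 * a * t - b)\<^sup>2 \<le> b\<^sup>2 - 4 * a * c"
    by (metis abs_le_square_iff abs_of_nonneg real_sqrt_ge_zero real_sqrt_pow2)
  then show ?thesis
    using assms(1) by (simp add: quadratic_le_zero_iff)
qed

text \<open>
  Evaluating the quadratic at the lower bound \<open>mu * dmax / (2 * lam * vmax)\<close> of (d) explains
  the threshold on \<open>dmax\<close> in (c): the value is nonpositive exactly when \<open>dmax\<close> is at most
  the threshold.
\<close>

lemma parameter_bounds:
  fixes dt lam mu dmax vmax M L :: real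
  assumes pos: "0 < M" "0 < L" "0 < vmax" "0 < lam" "lam < 1" "0 < mu"
    and parameters:
      "let s = sqrt ((1 - lam)\<^sup>2 * vmax\<^sup>2 - 4 * M * L * dmax);
           t1 = ((1 - lam) * vmax - s) / (2 * M * L);
           t2 = ((1 - lam) * vmax + s) / (2 * M * L);
           d1 = 2 * (lam * (1 - lam) * mu - 2 * lam\<^sup>2) * vmax\<^sup>2 / (mu\<^sup>2 * M * L);
           d2 = (1 - lam)\<^sup>2 * vmax\<^sup>2 / (4 * M * L);
           a = dmax \<in> {0<..d2};
           b = dt \<in> {t1..t2};
           c = dmax \<in> {0<..d1};
           d = dt \<in> {mu / (2 * lam * vmax) * dmax..t2}
       in (0 \<le> mu \<and> mu \<le> 2 * lam / (1 - lam) \<and> a \<and> b) \<or>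
          (2 * lam / (1 - lam) < mu \<and> mu < 4 * lam / (1 - lam) \<and>
             ((c \<and> d) \<or> (dmax \<in> {d1<..d2} \<and> b))) \<or>
          (4 * lam / (1 - lam) \<le> mu \<and> c \<and> d)"
  shows "0 < dmax" "M * L * dt\<^sup>2 - (1 - lam) * vmax * dt + dmax \<le> 0" "mu * dmax \<le> 2 * lam * vmax * dt"
proof -
  define A where "A = M * L"
  have A: "0 < A" "k * M * L = k * A" for k
    using pos by (auto simp: A_def)
  define b where "b = (1 - lam) * vmax"
  define t0 where "t0 = mu / (2 * lam * vmax) * dmax"
  define s where "s = sqrt (b\<^sup>2 - 4 * A * dmax)"
  define d1 where "d1 = 2 * (lam * (1 - lam) * mu - 2 * lam\<^sup>2) * vmax\<^sup>2 / (mu\<^sup>2 * A)"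
  define d2 where "d2 = b\<^sup>2 / (4 * A)"
  have b: "0 < b" "(1 - lam)\<^sup>2 * vmax\<^sup>2 = b\<^sup>2"
    using pos A(1) by (auto simp: b_def power_mult_distrib)
  \<comment> \<open>Three different arguments: Case I, the branch of Case II with (b), and the pair
    (c), (d), which is treated alike in Cases II and III.\<close>
  consider
      (I) "mu \<le> 2 * lam / (1 - lam)" "0 < dmax" "dmax \<le> d2" "(b - s) / (2 * A) \<le> dt" "dt \<le> (b + s) / (2 * A)"
    | (II) "2 * lam / (1 - lam) < mu" "mu < 4 * lam / (1 - lam)" "d1 < dmax" "dmax \<le> d2"
        "(b - s) / (2 * A) \<le> dt" "dt \<le> (b + s) / (2 * A)"
    | (cd) "0 < dmax" "dmax \<le> d1" "t0 \<le> dt" "dt \<le> (b + s) / (2 * A)"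
    using parameters
    unfolding Let_def A(2) b(2) b_def[symmetric] t0_def[symmetric] s_def[symmetric] d1_def[symmetric] d2_def[symmetric]
    by auto
  note cases = this
  have t0_iff: "A * t0\<^sup>2 - b * t0 + dmax \<le> 0 \<longleftrightarrow> dmax \<le> d1" if "0 < dmax"
  proof -
    have "4 * lam\<^sup>2 * vmax\<^sup>2 * (A * t0\<^sup>2 - b * t0 + dmax)
        = dmax * (dmax * (mu\<^sup>2 * A) - 2 * (lam * (1 - lam) * mu - 2 * lam\<^sup>2) * vmax\<^sup>2)"
      using pos A(1) by (simp add: t0_def b_def field_simps power2_eq_square)
    moreover have "A * t0\<^sup>2 - b * t0 + dmax \<le> 0 \<longleftrightarrow> 4 * lam\<^sup>2 * vmax\<^sup>2 * (A * t0\<^sup>2 - b * t0 + dmax) \<le> 0"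
      using pos A(1) by (simp add: mult_le_0_iff)
    moreover have "dmax \<le> d1 \<longleftrightarrow> dmax * (mu\<^sup>2 * A) - 2 * (lam * (1 - lam) * mu - 2 * lam\<^sup>2) * vmax\<^sup>2 \<le> 0"
      using pos A(1) by (simp add: d1_def pos_le_divide_eq)
    ultimately show ?thesis
      using that by (simp add: mult_le_0_iff)
  qed
  have between: "A * dt\<^sup>2 - b * dt + dmax \<le> 0" if "dmax \<le> d2" "(b - s) / (2 * A) \<le> dt" "dt \<le> (b + s) / (2 * A)"
  proof (rule quadratic_le_zero_between[OF A(1) _ that(2)])
    have "0 \<le> b\<^sup>2 - 4 * A * dmax"
      using that(1) pos A(1) by (simp add: d2_def field_simps)
    then show "(2 * A * ((b - s) / (2 * A)) - b)\<^sup>2 \<le> b\<^sup>2 - 4 * A * dmax"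
      using pos A(1) by (simp add: s_def)
  qed (use that in \<open>simp add: s_def\<close>)
  have t0_le: "t0 \<le> dt \<longleftrightarrow> mu * dmax \<le> 2 * lam * vmax * dt"
    using pos A(1) by (simp add: t0_def field_simps)
  have all: "0 < dmax \<and> A * dt\<^sup>2 - b * dt + dmax \<le> 0 \<and> t0 \<le> dt"
    using cases
  proof cases
    case I
    have q: "A * dt\<^sup>2 - b * dt + dmax \<le> 0"
      using between I by blast
    \<comment> \<open>Dropping the square from the quadratic inequality gives this, and the bound on
      \<open>mu\<close> in Case I is just what makes it imply the radius estimate.\<close>
    have "dmax \<le> b * dt"
      using q A(1) pos zero_le_power2[of dt] mult_nonneg_nonneg[of A "dt\<^sup>2"] by linarith
    have "mu * dmax \<le> 2 * lam / (1 - lam) * (b * dt)"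
      using I pos A(1) \<open>dmax \<le> b * dt\<close> by (intro mult_mono) auto
    also have "\<dots> = 2 * lam * vmax * dt"
      using pos A(1) by (simp add: b_def)
    finally show ?thesis
      using q I t0_le by blast
  next
    case II
    \<comment> \<open>In this branch \<open>dmax\<close> is bounded below by \<open>d1\<close> only,
      whose positivity comes from the lower bound on \<open>mu\<close>.\<close>
    have "0 < d1"
    proof -
      have "2 * lam < (1 - lam) * mu"
        using II(1) pos by (simp add: pos_divide_less_eq mult.commute)
      then have "lam * (2 * lam) < lam * ((1 - lam) * mu)"
        using pos A(1) by (intro mult_strict_left_mono) auto
      then have "0 < lam * (1 - lam) * mu - 2 * lam\<^sup>2"
        by (simp add: power2_eq_square mult_ac)
      then show ?thesis
        unfolding d1_def using pos A(1) by (intro divide_pos_pos mult_pos_pos) auto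
    qed
    then have dmax: "0 < dmax"
      using II by linarith
    \<comment> \<open>Since \<open>d1 < dmax\<close>, the point \<open>t0\<close> lies outside the
      interval of solutions. It lies to the left, because \<open>mu < 4 * lam / (1 - lam)\<close>
      and \<open>dmax \<le> d2\<close> keep it at or before the vertex \<open>b / (2 * A)\<close>.
      So the lower bound in (b) already exceeds or equals \<open>t0\<close>.\<close>
    have "\<not> A * t0\<^sup>2 - b * t0 + dmax \<le> 0"
      using t0_iff[OF dmax] II by linarith
    then have "b\<^sup>2 - 4 * A * dmax < (b - 2 * A * t0)\<^sup>2"
      using pos A(1) by (simp add: quadratic_le_zero_iff power2_commute)
    moreover have "0 \<le> b - 2 * A * t0"
    proof -
      have "2 * A * t0 \<le> 2 * A * (mu / (2 * lam * vmax) * d2)"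
        unfolding t0_def using II pos A(1) by (intro mult_left_mono) auto
      also have "\<dots> = b * (mu * (1 - lam) / (4 * lam))"
        using pos A(1) by (simp add: d2_def b_def field_simps power2_eq_square)
      also have "\<dots> \<le> b * 1"
        using II(2) pos b by (intro mult_left_mono) (auto simp: field_simps)
      finally show ?thesis by simp
    qed
    ultimately have "s \<le> b - 2 * A * t0"
      unfolding s_def by (intro real_le_lsqrt) auto
    then have "t0 \<le> (b - s) / (2 * A)"
      using pos A(1) by (simp add: field_simps)
    then show ?thesis
      using between II dmax by auto
  next
    case cd
    have "A * dt\<^sup>2 - b * dt + dmax \<le> 0"
    proof (rule quadratic_le_zero_between[OF A(1) _ cd(3)])
      show "(2 * A * t0 - b)\<^sup>2 \<le> b\<^sup>2 - 4 * A * dmax"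
        using t0_iff[OF cd(1)] cd(2) quadratic_le_zero_iff[OF A(1)] by blast
    qed (use cd in \<open>simp add: s_def\<close>)
    then show ?thesis
      using cd by blast
  qed
  then show "0 < dmax" "M * L * dt\<^sup>2 - (1 - lam) * vmax * dt + dmax \<le> 0" "mu * dmax \<le> 2 * lam * vmax * dt"
    using t0_le by (auto simp: b_def A_def)
qed

theorem corollary6p7:
  fixes D :: "(real ^ 'n) set"
    and nbr :: "'i::finite \<Rightarrow> 'i list"
    and f :: "'i \<Rightarrow> real ^ 'n \<Rightarrow> (real ^ 'n) list \<Rightarrow> real ^ 'n"
    and M vmax L1 L2 L dt lam mu dmax :: real
    and I :: "'l set" and S :: "'l \<Rightarrow> (real ^ 'n) set"
    and W :: "(real ^ 'n) set"
  assumes "\<And>i. distinct (nbr i)" and "\<And>i. i \<notin> set (nbr i)"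
    and "D \<noteq> {}" and "open D" and "connected D"
    and "\<And>i x xs. x \<in> D \<Longrightarrow> xs \<in> tuples (length (nbr i)) D \<Longrightarrow> norm (f i x xs) \<le> M"
    and "0 < vmax" and "vmax < M" and "0 < L1" and "0 < L2"
    and "\<And>i x xs ys. x \<in> D \<Longrightarrow> xs \<in> tuples (length (nbr i)) D \<Longrightarrow> ys \<in> tuples (length (nbr i)) D \<Longrightarrow>
           norm (f i x xs - f i x ys) \<le> L1 * tuple_dist (x # xs) (x # ys)"
    and "\<And>i x y xs. x \<in> D \<Longrightarrow> y \<in> D \<Longrightarrow> xs \<in> tuples (length (nbr i)) D \<Longrightarrow>
           norm (f i x xs - f i y xs) \<le> L2 * tuple_dist (x # xs) (y # xs)"
    and "invariance_assumption D nbr f vmax"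
    and "cell_decomposition D I S"
    and dmax: "dmax = (SUP l\<in>I. diameter (S l))"
    and "0 < dt" and "0 < lam" and "lam < 1" and "0 < mu"
    and W: "W = cball 0 (lam * vmax)"
    and L: "L = (MAX i. 3 * L2 + 4 * L1 * sqrt (real (length (nbr i))))"
    and parameters:
      "let s = sqrt ((1 - lam)\<^sup>2 * vmax\<^sup>2 - 4 * M * L * dmax);
           t1 = ((1 - lam) * vmax - s) / (2 * M * L);
           t2 = ((1 - lam) * vmax + s) / (2 * M * L);
           d1 = 2 * (lam * (1 - lam) * mu - 2 * lam\<^sup>2) * vmax\<^sup>2 / (mu\<^sup>2 * M * L);
           d2 = (1 - lam)\<^sup>2 * vmax\<^sup>2 / (4 * M * L);
           a = dmax \<in> {0<..d2};
           b = dt \<in> {t1..t2};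
           c = dmax \<in> {0<..d1};
           d = dt \<in> {mu / (2 * lam * vmax) * dmax..t2}
       in (0 \<le> mu \<and> mu \<le> 2 * lam / (1 - lam) \<and> a \<and> b) \<or>
          (2 * lam / (1 - lam) < mu \<and> mu < 4 * lam / (1 - lam) \<and>
             ((c \<and> d) \<or> (dmax \<in> {d1<..d2} \<and> b))) \<or>
          (4 * lam / (1 - lam) \<le> mu \<and> c \<and> d)"
  shows "\<forall>i. \<forall>li \<in> cell_configs nbr I i.
           infinite (Post D nbr f I S M vmax dt W i li) \<or>
           card (Post D nbr f I S M vmax dt W i li) \<ge>
             (if mu ^ CARD('n) \<in> \<nat> then nat \<lfloor>mu ^ CARD('n)\<rfloor> else nat \<lfloor>mu ^ CARD('n)\<rfloor> + 1)"
proof (intro allI ballI)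
  fix i li assume li: "li \<in> cell_configs nbr I i"
  have M: "0 < M"
    using assms(7,8) by linarith
  have L_ge: "3 * L2 + 4 * L1 * sqrt (real (length (nbr j))) \<le> L" for j
    unfolding L by (intro Max_ge) auto
  have "0 < 3 * L2 + 4 * L1 * sqrt (real (length (nbr i)))"
    using assms(9,10) by (intro add_pos_nonneg) auto
  then have L_pos: "0 < L"
    using L_ge[of i] by linarith
  note pb = parameter_bounds[OF M L_pos \<open>0 < vmax\<close> \<open>0 < lam\<close> \<open>lam < 1\<close> \<open>0 < mu\<close> parameters]
  have cell_dist: "dist x y \<le> dmax" if "l \<in> I" "x \<in> S l" "y \<in> S l" for l x y
  proof -
    have "dist x y \<le> diameter (S l)"
      using that assms(14) by (intro diameter_bounded_bound) (auto simp: cell_decomposition_def)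
    also have "\<dots> \<le> dmax"
      unfolding dmax using that assms(14) by (intro cSUP_upper) (auto simp: cell_decomposition_def)
    finally show ?thesis .
  qed
  have budget: "(3 * L2 + 4 * L1 * sqrt (length (nbr j))) * M * dt + dmax / dt \<le> (1 - lam) * vmax" for j
  proof -
    have "(3 * L2 + 4 * L1 * sqrt (length (nbr j))) * (M * dt) \<le> L * (M * dt)"
      using L_ge[of j] M \<open>0 < dt\<close> by (intro mult_right_mono) auto
    moreover have "L * (M * dt) + dmax / dt \<le> (1 - lam) * vmax"
      using pb(2) \<open>0 < dt\<close> by (simp add: field_simps power2_eq_square)
    ultimately show ?thesis
      by (simp add: mult.assoc)
  qed
  interpret cell_abstraction D nbr f M vmax L1 L2 I S dt lam dmax
  proof (intro cell_abstraction.intro cell_abstraction_axioms.intro)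
    show "multi_agent_system D nbr f M vmax L1 L2"
      by (rule multi_agent_system.intro) (fact assms)+
  qed (fact assms pb cell_dist budget)+
  let ?Post = "Post D nbr f I S M vmax dt W i li"
  show "infinite ?Post \<or> card ?Post \<ge>
      (if mu ^ CARD('n) \<in> \<nat> then nat \<lfloor>mu ^ CARD('n)\<rfloor> else nat \<lfloor>mu ^ CARD('n)\<rfloor> + 1)"
  proof (cases "finite ?Post")
    case True
    have le: "mu ^ CARD('n) \<le> card ?Post"
      using card_Post_ge[OF li True[unfolded W] \<open>0 < mu\<close> pb(3)] W by simp
    show ?thesis
    proof (cases "mu ^ CARD('n) \<in> \<nat>")
      case True
      then show ?thesis
        using le by (auto simp: Nats_def)
    next
      case False
      \<comment> \<open>A cardinality is a natural number, so equality is excluded; strictness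
        accounts for the additional 1.\<close>
      then have "mu ^ CARD('n) < card ?Post"
        using le of_nat_in_Nats[of "card ?Post", where 'a = real] by (auto simp: order_le_less)
      then have "nat \<lfloor>mu ^ CARD('n)\<rfloor> < card ?Post"
        using \<open>0 < mu\<close> by (simp add: nat_less_iff floor_less_iff)
      then show ?thesis
        using False by simp
    qed
  qed simp
qed

end
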